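(* There exists bound coherence in operations: there exists a CPTP map $T$ between finite-dimensional systems such that $C_{\mathrm{gen}}(T)=0$ but $C_{\mathrm{sim}}(T)>0$.
   Context: All systems are finite-dimensional Hilbert spaces, each with a fixed orthonormal basis $\{|i\rangle\}$ (the incoherent basis); a tensor product of systems carries the product basis. $|A|$ denotes the dimension of $A$; $\log$ is to base 2. A state is incoherent if its density matrix is diagonal in the incoherent basis. An operator $K$ between two systems is incoherent if $K\delta K^\dagger$ is diagonal in the incoherent basis for every incoherent state $\delta$. An incoherent operation (IO) is a CPTP map having a Kraus representation $\rho\mapsto\sum_\alpha K_\alpha\rho K_\alpha^\dagger$, $\sum_\alpha K_\alpha^\dagger K_\alpha=1$, with all $K_\alpha$ incoherent. Maximally coherent state: $|\Psi_d\rangle=\frac1{\sqrt d}\sum_{i=0}^{d-1}|i\rangle$, $\Psi_d=|\Psi_d\rangle\langle\Psi_d|$. Coherence generating capacity. A coherence generation protocol using $T:A\to B$ exactly $n$ times consists of finite-dimensional auxiliary systems $A_0,\dots,A_n$ (of arbitrary dimension), an incoherent initial state $\rho_0$ on $A\otimes A_0$, and incoherent operations $\mathcal I_{t+1}:B\otimes A_t\to A\otimes A_{t+1}$, $t=0,\dots,n-1$. It produces states $\rho_{t+1}=\mathcal I_{t+1}\bigl((T\otimes\mathrm{id}_{A_t})\rho_t\bigr)$ on $A\otimes A_{t+1}$. It has rate $R$ and error $\epsilon$ if $|A_n|=2^{nR}$ and $\langle\Psi_{2^{nR}}|\mathrm{Tr}_A\rho_n|\Psi_{2^{nR}}\rangle\ge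 1-\epsilon$ (here $|\Psi_{2^{nR}}\rangle$ is a vector of $A_n$). $C_{\mathrm{gen}}(T)$ is the maximum $R$ for which there exist coherence generation protocols for all $n$ with errors tending to $0$ and rates converging to $R$ as $n\to\infty$. Simulation cost. An $n$-block incoherent simulation of $T:A\to B$ with error $\epsilon$ and coherent resource $\Psi_d$ (on a $d$-dimensional space $D$) is an incoherent operation $\mathcal I:A^{\otimes n}\otimes D\to B^{\otimes n}$ such that $T'(\rho):=\mathcal I(\rho\otimes\Psi_d)$ satisfies $\|T'-T^{\otimes n}\|_\diamond\le\epsilon$, where $\|T'-T^{\otimes n}\|_\diamond=\sup_{|\phi\rangle\in A^{\otimes n}\otimes C}\|(T'\otimes\mathrm{id}_C)\phi-(T^{\otimes n}\otimes\mathrm{id}_C)\phi\|_1$, the supremum being over all ancilla systems $C$ and pure states. Its rate is $\frac1n\log d$. $C_{\mathrm{sim}}(T)$ is the smallest $R$ such that there exist $n$-block incoherent simulations of $T$ with error tending to $0$ and rate tending to $R$ as $n\to\infty$. *)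

theory Defs
  imports
    Complex_Main
    "HOL-Library.Extended_Real"
    "HOL-Computational_Algebra.Polynomial"
    "Jordan_Normal_Form.Matrix"
    "Jordan_Normal_Form.Char_Poly"
    "Jordan_Normal_Form.Schur_Decomposition"
begin

text \<open>
  A system is represented by its dimension \<open>d \<ge> 1\<close>, with the standard basis of \<open>\<complex>\<^sup>d\<close> as its
  incoherent basis. In a tensor product of systems of dimensions \<open>a\<close> and \<open>b\<close> the product basis
  vector \<open>|i\<rangle>|j\<rangle>\<close> has index \<open>i * b + j\<close>. A linear map of operators is a function on complex
  matrices; only its values on the square matrices of its input dimension matter.
\<close>

section \<open>Matrices\<close>

definition mtrace :: "complex mat \<Rightarrow> complex" where
  "mtrace X = (\<Sum>i<dim_row X. X $$ (i, i))"

text \<open>Since \<open>v \<bullet>c w\<close> conjugates \<open>w\<close>, the scalar product below is \<open>\<langle>v|X|v\<rangle>\<close>;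
  the order on complex numbers makes it real and nonnegative.\<close>

definition psd :: "nat \<Rightarrow> complex mat \<Rightarrow> bool" where
  "psd n X \<longleftrightarrow> X \<in> carrier_mat n n \<and> (\<forall>v \<in> carrier_vec n. 0 \<le> (X *\<^sub>v v) \<bullet>c v)"

definition kron :: "complex mat \<Rightarrow> complex mat \<Rightarrow> complex mat" where
  "kron X Y = mat (dim_row X * dim_row Y) (dim_col X * dim_col Y)
     (\<lambda>(i, j). X $$ (i div dim_row Y, j div dim_col Y) * Y $$ (i mod dim_row Y, j mod dim_col Y))"

definition ket_bra :: "complex vec \<Rightarrow> complex mat" where
  "ket_bra v = mat (dim_vec v) (dim_vec v) (\<lambda>(i, j). v $ i * cnj (v $ j))"

definition basis_op :: "nat \<Rightarrow> nat \<Rightarrow> nat \<Rightarrow> complex mat" where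
  "basis_op n i j = mat n n (\<lambda>(k, l). if k = i \<and> l = j then 1 else 0)"

text \<open>The sum of the singular values, that is, of the square roots of the eigenvalues of
  \<open>X\<^sup>\<dagger>X\<close> with multiplicity.\<close>

definition trace_norm :: "complex mat \<Rightarrow> real" where
  "trace_norm X = (\<Sum>x\<in>#proots (char_poly (mat_adjoint X * X)). sqrt (Re x))"

definition ptrace_fst :: "nat \<Rightarrow> nat \<Rightarrow> complex mat \<Rightarrow> complex mat" where
  "ptrace_fst a b X = mat b b (\<lambda>(i, j). \<Sum>k<a. X $$ (k * b + i, k * b + j))"

section \<open>Maps of operators\<close>

type_synonym op_map = "complex mat \<Rightarrow> complex mat"

definition linear_map :: "nat \<Rightarrow> nat \<Rightarrow> op_map \<Rightarrow> bool" where
  "linear_map a b T \<longleftrightarrow>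
     (\<forall>X \<in> carrier_mat a a. T X \<in> carrier_mat b b) \<and>
     (\<forall>X \<in> carrier_mat a a. \<forall>Y \<in> carrier_mat a a. T (X + Y) = T X + T Y) \<and>
     (\<forall>c. \<forall>X \<in> carrier_mat a a. T (c \<cdot>\<^sub>m X) = c \<cdot>\<^sub>m T X)"

text \<open>The tensor product of the linear maps \<open>S\<close>, from dimension \<open>a\<close> to \<open>b\<close>, and \<open>T\<close>, from \<open>a'\<close> to
  \<open>b'\<close>: the linear map sending \<open>|i\<rangle>\<langle>j| \<otimes> |i'\<rangle>\<langle>j'|\<close> to \<open>S(|i\<rangle>\<langle>j|) \<otimes> T(|i'\<rangle>\<langle>j'|)\<close>.\<close>

definition tensor_map ::
  "nat \<Rightarrow> nat \<Rightarrow> op_map \<Rightarrow> nat \<Rightarrow> nat \<Rightarrow> op_map \<Rightarrow> op_map" where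
  "tensor_map a b S a' b' T X = mat (b * b') (b * b') (\<lambda>kl.
     \<Sum>i<a. \<Sum>j<a. \<Sum>i'<a'. \<Sum>j'<a'.
       X $$ (i * a' + i', j * a' + j') * kron (S (basis_op a i j)) (T (basis_op a' i' j')) $$ kl)"

abbreviation tensor_id :: "nat \<Rightarrow> nat \<Rightarrow> op_map \<Rightarrow> nat \<Rightarrow> op_map" where
  "tensor_id a b T c \<equiv> tensor_map a b T c c id"

primrec tensor_power :: "nat \<Rightarrow> nat \<Rightarrow> op_map \<Rightarrow> nat \<Rightarrow> op_map" where
  "tensor_power a b T 0 = id"
| "tensor_power a b T (Suc n) = tensor_map a b T (a ^ n) (b ^ n) (tensor_power a b T n)"

definition cptp :: "nat \<Rightarrow> nat \<Rightarrow> op_map \<Rightarrow> bool" where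
  "cptp a b T \<longleftrightarrow> linear_map a b T \<and>
     (\<forall>c X. psd (a * c) X \<longrightarrow> psd (b * c) (tensor_id a b T c X)) \<and>
     (\<forall>X \<in> carrier_mat a a. mtrace (T X) = mtrace X)"

definition diamond_dist :: "nat \<Rightarrow> nat \<Rightarrow> op_map \<Rightarrow> op_map \<Rightarrow> ereal" where
  "diamond_dist a b S T =
     Sup {ereal (trace_norm (tensor_id a b S c (ket_bra \<phi>) - tensor_id a b T c (ket_bra \<phi>))) | c \<phi>.
            \<phi> \<in> carrier_vec (a * c) \<and> \<phi> \<bullet>c \<phi> = 1}"

section \<open>Incoherent states and operations\<close>

definition density :: "nat \<Rightarrow> complex mat \<Rightarrow> bool" where
  "density n \<rho> \<longleftrightarrow> psd n \<rho> \<and> mtrace \<rho> = 1"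

definition incoherent_state :: "nat \<Rightarrow> complex mat \<Rightarrow> bool" where
  "incoherent_state n \<rho> \<longleftrightarrow> density n \<rho> \<and> diagonal_mat \<rho>"

definition incoherent_operator :: "nat \<Rightarrow> nat \<Rightarrow> complex mat \<Rightarrow> bool" where
  "incoherent_operator a b K \<longleftrightarrow> K \<in> carrier_mat b a \<and>
     (\<forall>\<delta>. incoherent_state a \<delta> \<longrightarrow> diagonal_mat (K * \<delta> * mat_adjoint K))"

definition kraus_rep :: "nat \<Rightarrow> nat \<Rightarrow> complex mat list \<Rightarrow> op_map \<Rightarrow> bool" where
  "kraus_rep a b Ks T \<longleftrightarrow> (\<forall>K \<in> set Ks. K \<in> carrier_mat b a) \<and>
     foldr (+) (map (\<lambda>K. mat_adjoint K * K) Ks) (0\<^sub>m a a) = 1\<^sub>m a \<and>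
     (\<forall>\<rho> \<in> carrier_mat a a.
        T \<rho> = foldr (+) (map (\<lambda>K. K * \<rho> * mat_adjoint K) Ks) (0\<^sub>m b b))"

definition incoherent_operation :: "nat \<Rightarrow> nat \<Rightarrow> op_map \<Rightarrow> bool" where
  "incoherent_operation a b T \<longleftrightarrow> cptp a b T \<and>
     (\<exists>Ks. kraus_rep a b Ks T \<and> (\<forall>K \<in> set Ks. incoherent_operator a b K))"

definition max_coh_vec :: "nat \<Rightarrow> complex vec" where
  "max_coh_vec d = vec d (\<lambda>_. complex_of_real (1 / sqrt (real d)))"

definition max_coh_state :: "nat \<Rightarrow> complex mat" where
  "max_coh_state d = ket_bra (max_coh_vec d)"

section \<open>Coherence generating capacity\<close>

primrec protocol_state ::
  "nat \<Rightarrow> nat \<Rightarrow> op_map \<Rightarrow> (nat \<Rightarrow> nat) \<Rightarrow> complex mat \<Rightarrow> (nat \<Rightarrow> op_map) \<Rightarrow> nat \<Rightarrow> complex mat" where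
  "protocol_state a b T d \<rho>\<^sub>0 \<I> 0 = \<rho>\<^sub>0"
| "protocol_state a b T d \<rho>\<^sub>0 \<I> (Suc t) =
     \<I> (Suc t) (tensor_id a b T (d t) (protocol_state a b T d \<rho>\<^sub>0 \<I> t))"

text \<open>Here \<open>d t\<close> is the dimension of the auxiliary system \<open>A\<^sub>t\<close>.\<close>

definition generation_protocol ::
  "nat \<Rightarrow> nat \<Rightarrow> op_map \<Rightarrow> nat \<Rightarrow> (nat \<Rightarrow> nat) \<Rightarrow> complex mat \<Rightarrow> (nat \<Rightarrow> op_map) \<Rightarrow> bool" where
  "generation_protocol a b T n d \<rho>\<^sub>0 \<I> \<longleftrightarrow>
     (\<forall>t\<le>n. 0 < d t) \<and> incoherent_state (a * d 0) \<rho>\<^sub>0 \<and>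
     (\<forall>t<n. incoherent_operation (b * d t) (a * d (Suc t)) (\<I> (Suc t)))"

definition generation_with ::
  "nat \<Rightarrow> nat \<Rightarrow> op_map \<Rightarrow> nat \<Rightarrow> real \<Rightarrow> real \<Rightarrow> bool" where
  "generation_with a b T n R \<epsilon> \<longleftrightarrow>
     (\<exists>d \<rho>\<^sub>0 \<I>. generation_protocol a b T n d \<rho>\<^sub>0 \<I> \<and>
        real (d n) = 2 powr (real n * R) \<and>
        Re ((ptrace_fst a (d n) (protocol_state a b T d \<rho>\<^sub>0 \<I> n) *\<^sub>v max_coh_vec (d n))
            \<bullet>c max_coh_vec (d n)) \<ge> 1 - \<epsilon>)"

definition generation_achievable :: "nat \<Rightarrow> nat \<Rightarrow> op_map \<Rightarrow> real \<Rightarrow> bool" where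
  "generation_achievable a b T R \<longleftrightarrow>
     (\<exists>r \<epsilon>. (\<forall>n\<ge>1. generation_with a b T n (r n) (\<epsilon> n)) \<and>
        r \<longlonglongrightarrow> R \<and> \<epsilon> \<longlonglongrightarrow> 0)"

definition C_gen :: "nat \<Rightarrow> nat \<Rightarrow> op_map \<Rightarrow> ereal" where
  "C_gen a b T = Sup {ereal R | R. generation_achievable a b T R}"

section \<open>Simulation cost\<close>

definition simulation ::
  "nat \<Rightarrow> nat \<Rightarrow> op_map \<Rightarrow> nat \<Rightarrow> nat \<Rightarrow> real \<Rightarrow> op_map \<Rightarrow> bool" where
  "simulation a b T n d \<epsilon> \<I> \<longleftrightarrow> 0 < d \<and> incoherent_operation (a ^ n * d) (b ^ n) \<I> \<and>
     diamond_dist (a ^ n) (b ^ n) (\<lambda>\<rho>. \<I> (kron \<rho> (max_coh_state d))) (tensor_power a b T n)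
       \<le> ereal \<epsilon>"

definition simulation_achievable :: "nat \<Rightarrow> nat \<Rightarrow> op_map \<Rightarrow> real \<Rightarrow> bool" where
  "simulation_achievable a b T R \<longleftrightarrow>
     (\<exists>d \<epsilon>. (\<forall>n\<ge>1. \<exists>\<I>. simulation a b T n (d n) (\<epsilon> n) \<I>) \<and>
        (\<lambda>n. 1 / real n * log 2 (real (d n))) \<longlonglongrightarrow> R \<and> \<epsilon> \<longlonglongrightarrow> 0)"

definition C_sim :: "nat \<Rightarrow> nat \<Rightarrow> op_map \<Rightarrow> ereal" where
  "C_sim a b T = Inf {ereal R | R. simulation_achievable a b T R}"

end

(* Let C be the 6 x 6 Paley conference matrix and U = C / sqrt 5, a Hermitian involution of trace 0
   whose entries have modulus at most 1 / sqrt 5. The channel T from a qubit to dimension 6,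
   T(X) = (tr X * 1 + (X_01 + X_10) U) / 6, maps incoherent states to the maximally mixed state, so
   it generates no coherence.

   On the other hand tr(U T(Psi_2)) = 1, hence U^(n) := U \<otimes> ... \<otimes> U has expectation 1 in
   T^(n)(Psi_{2^n}). An incoherent operation turns Psi_{2^n} \<otimes> Psi_d into a mixture of vectors v
   with at most N = 2^n d nonzero entries, because every column of an incoherent Kraus operator has
   at most one nonzero entry. As the entries of U^(n) are bounded by 5^(-n/2), Cauchy-Schwarz gives
   |<v|U^(n)|v>| <= 5^(-n/2) N |v|^2. So a simulation with error eps needs
   1 - eps <= d (2 / sqrt 5)^n, and C_sim(T) >= log(sqrt 5 / 2) > 0. *)

theory Submission
  imports Defs "HOL-Analysis.L2_Norm"
begin

text \<open>In the Hadamard basis of the qubit, T is a measurement followed by a preparation: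
  outcome + yields (1 + U) / 6 and outcome - yields (1 - U) / 6, the normalized projectors onto the
  eigenspaces of U. Basis states give both outcomes equally often, which averages the projectors to
  the maximally mixed state, whereas Psi_2 singles out one of them. The order 6 comes from the cost
  bound. The largest entry of a unitary of order b has modulus at least 1 / sqrt b, and the bound
  has content only if twice that entry is below 1, which forces b > 4. A conference matrix of order
  6 gives 1 / sqrt 5, and its zero diagonal makes the trace vanish. The witness U^(n) is
  multiplicative, so the bound holds for each block length separately and no entropic continuity
  estimate enters. The analytic obstacle is the trace norm, defined by roots of a characteristic
  polynomial: its duality with contractions has to be derived from an orthonormal
  eigenbasis.\<close>

section \<open>Matrix entries, traces and product indices\<close>

lemma mat_adjoint_dim [simp]:
  "dim_row (mat_adjoint X) = dim_col X" "dim_col (mat_adjoint X) = dim_row X"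
  by (simp_all add: mat_adjoint_def)

lemma mat_adjoint_carrier [simp]:
  "X \<in> carrier_mat m n \<Longrightarrow> mat_adjoint X \<in> carrier_mat n m"
  by (intro carrier_matI) auto

lemma mat_adjoint_index [simp]:
  assumes "i < dim_col X" "j < dim_row X"
  shows "mat_adjoint X $$ (i, j) = cnj (X $$ (j, i))"
  using assms by (simp add: mat_adjoint_def mat_of_rows_index)

lemma mat_mult_index:
  assumes "X \<in> carrier_mat l m" "Y \<in> carrier_mat m n" "i < l" "j < n"
  shows "(X * Y) $$ (i, j) = (\<Sum>k<m. X $$ (i, k) * Y $$ (k, j))"
  using assms by (auto simp: scalar_prod_def atLeast0LessThan)

lemma mat_mult_vec_index:
  assumes "X \<in> carrier_mat m n" "v \<in> carrier_vec n" "i < m"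
  shows "(X *\<^sub>v v) $ i = (\<Sum>k<n. X $$ (i, k) * v $ k)"
  using assms by (auto simp: scalar_prod_def atLeast0LessThan)

lemma cscalar_prod_sum:
  fixes v w :: "complex vec"
  assumes "w \<in> carrier_vec n"
  shows "v \<bullet>c w = (\<Sum>i<n. v $ i * cnj (w $ i))"
  using assms by (auto simp: scalar_prod_def atLeast0LessThan)

lemma mtrace_sum: "X \<in> carrier_mat n n \<Longrightarrow> mtrace X = (\<Sum>i<n. X $$ (i, i))"
  by (auto simp: mtrace_def)

lemma mtrace_minus:
  assumes "X \<in> carrier_mat n n" "Y \<in> carrier_mat n n"
  shows "mtrace (X - Y) = mtrace X - mtrace Y"
  using assms by (auto simp: mtrace_def sum_subtractf)

lemma mtrace_mult_commute:
  assumes "X \<in> carrier_mat m n" "Y \<in> carrier_mat n m"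
  shows "mtrace (X * Y) = mtrace (Y * X)"
proof -
  have "mtrace (X * Y) = (\<Sum>i<m. \<Sum>k<n. X $$ (i, k) * Y $$ (k, i))"
    using assms by (simp add: mtrace_sum[of _ m] mat_mult_index[OF assms] del: index_mult_mat(1))
  also have "\<dots> = (\<Sum>k<n. \<Sum>i<m. Y $$ (k, i) * X $$ (i, k))"
    by (subst sum.swap) (simp add: mult.commute)
  also have "\<dots> = mtrace (Y * X)"
    using assms by (simp add: mtrace_sum[of _ n] mat_mult_index[OF assms(2,1)] del: index_mult_mat(1))
  finally show ?thesis .
qed

lemma sum_lessThan_mult:
  fixes f :: "nat \<Rightarrow> 'a::comm_monoid_add"
  shows "(\<Sum>k<a * b. f k) = (\<Sum>i<a. \<Sum>j<b. f (i * b + j))"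
proof -
  have "sum f {i * b..<i * b + b} = (\<Sum>j<b. f (i * b + j))" for i
    using sum.shift_bounds_nat_ivl[of f 0 "i * b" b]
    by (simp add: add.commute atLeast0LessThan)
  thus ?thesis by (simp flip: sum.nat_group)
qed

lemma mult_add_less:
  fixes i j a b :: nat
  assumes "i < a" "j < b"
  shows "i * b + j < a * b"
proof -
  have "i * b + j < Suc i * b" using assms by simp
  also have "\<dots> \<le> a * b" using assms by (intro mult_right_mono) auto
  finally show ?thesis .
qed

section \<open>The trace norm\<close>

text \<open>By Schur triangularization the trace is the sum of the \<open>n\<close> roots of the
  characteristic polynomial with multiplicity; if all of them were \<open>s\<close>, it would be
  \<open>n * s\<close>. A condition on the trace alone thus produces an eigenvalue away from a
  prescribed number.\<close>

lemma exists_eigenvector_neq: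
  fixes M :: "complex mat"
  assumes M: "M \<in> carrier_mat n n" and tr: "mtrace M \<noteq> of_nat n * s"
  obtains lam u where "lam \<noteq> s" "u \<in> carrier_vec n" "u \<noteq> 0\<^sub>v n" "M *\<^sub>v u = lam \<cdot>\<^sub>v u"
proof -
  obtain es where es: "char_poly M = (\<Prod>e\<leftarrow>es. [:- e, 1:])"
    using char_poly_factorized[OF M] by blast
  obtain B P Q where sd: "schur_decomposition M es = (B, P, Q)" by (cases "schur_decomposition M es") auto
  note w = schur_decomposition[OF M es sd]
  have c: "B \<in> carrier_mat n n" "P \<in> carrier_mat n n" "Q \<in> carrier_mat n n"
    and QP: "Q * P = 1\<^sub>m n" and eq: "M = P * B * Q"
    using similar_mat_witD2[OF M] w by auto
  have "mtrace M = mtrace (Q * (P * B))" unfolding eq using c by (intro mtrace_mult_commute) auto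
  also have "Q * (P * B) = B" using c QP by (simp flip: assoc_mult_mat)
  also have "mtrace B = sum_list (diag_mat B)"
    by (simp add: mtrace_def diag_mat_def sum_list_distinct_conv_sum_set atLeast0LessThan)
  finally have trs: "mtrace M = sum_list es" using w by simp
  have len: "length es = n" using w c by (auto simp: diag_mat_def)
  have "\<exists>e\<in>set es. e \<noteq> s"
  proof (rule ccontr)
    assume "\<not> ?thesis"
    hence "es = replicate n s" using len by (intro replicate_eqI) auto
    thus False using trs tr by (simp add: sum_list_replicate)
  qed
  then obtain e where e: "e \<in> set es" "e \<noteq> s" by blast
  have "poly (char_poly M) e = 0"
    unfolding es using e(1) by (induction es) auto
  hence "eigenvalue M e" using eigenvalue_root_char_poly[OF M] by simp
  then obtain u where "eigenvector M u e" unfolding eigenvalue_def by blast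
  thus ?thesis using that[OF e(2), of u] M unfolding eigenvector_def by auto
qed

text \<open>Eigenvectors are found one by one. Moving the eigenvalues \<open>\<mu>\<^sub>a\<close> already found to a real
  number \<open>s\<close> different from the mean of the remaining ones yields a Hermitian matrix that has, by its
  trace, an eigenvalue other than \<open>s\<close>; the corresponding eigenvectors are orthogonal to those found.\<close>

lemma hermitian_orthonormal_eigenvectors:
  fixes H :: "nat \<Rightarrow> nat \<Rightarrow> complex"
  assumes herm: "\<And>i j. i < n \<Longrightarrow> j < n \<Longrightarrow> H i j = cnj (H j i)" and "k \<le> n"
  shows "\<exists>v (\<mu> :: nat \<Rightarrow> real). (\<forall>a<k. \<forall>i<n. (\<Sum>j<n. H i j * v a j) = of_real (\<mu> a) * v a i) \<and>
    (\<forall>a<k. \<forall>b<k. (\<Sum>i<n. v a i * cnj (v b i)) = (if a = b then 1 else 0))"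
  using \<open>k \<le> n\<close>
proof (induction k)
  case 0
  show ?case by simp
next
  case (Suc k)
  then obtain v and \<mu> :: "nat \<Rightarrow> real" where
    "(\<forall>a<k. \<forall>i<n. (\<Sum>j<n. H i j * v a j) = of_real (\<mu> a) * v a i) \<and>
    (\<forall>a<k. \<forall>b<k. (\<Sum>i<n. v a i * cnj (v b i)) = (if a = b then 1 else 0))"
    using Suc_leD by blast
  hence
    ev: "\<And>a i. a < k \<Longrightarrow> i < n \<Longrightarrow> (\<Sum>j<n. H i j * v a j) = of_real (\<mu> a) * v a i" and
    on: "\<And>a b. a < k \<Longrightarrow> b < k \<Longrightarrow> (\<Sum>i<n. v a i * cnj (v b i)) = (if a = b then 1 else 0)"
    by blast+
  define t where "t = (\<Sum>i<n. H i i) - (\<Sum>a<k. of_real (\<mu> a))"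
  \<comment> \<open>The shifted matrix will have trace \<open>t + k * s\<close>, which equals
    \<open>n * s\<close> only if \<open>s\<close> is the mean \<open>t / (n - k)\<close> of the
    missing eigenvalues. Adding 1 moves \<open>s\<close> off that mean, as a comparison of real
    parts shows.\<close>
  define s where "s = Re t / real (n - k) + 1"
  have nk: "real (n - k) > 0" using Suc.prems by simp
  have "Re t \<noteq> real (n - k) * s"
  proof -
    have "real (n - k) * s = Re t + real (n - k)"
      unfolding s_def using nk by (simp add: distrib_left)
    thus ?thesis using nk by simp
  qed
  hence ts: "t \<noteq> of_nat (n - k) * of_real s" by (metis Re_complex_of_real of_real_mult of_real_of_nat_eq)
  define c where "c a = complex_of_real (\<mu> a - s)" for a
  have c_cnj: "cnj (c a) = c a" for a by (simp add: c_def)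
  define H' where "H' i j = H i j - (\<Sum>a<k. c a * (v a i * cnj (v a j)))" for i j
  have deflate: "(\<Sum>j<n. H' i j * w j)
      = (\<Sum>j<n. H i j * w j) - (\<Sum>b<k. c b * v b i * (\<Sum>j<n. w j * cnj (v b j)))" for i w
  proof -
    have "H' i j * w j = H i j * w j - (\<Sum>b<k. c b * v b i * (w j * cnj (v b j)))" for j
      by (simp add: H'_def right_diff_distrib sum_distrib_left mult_ac)
    hence "(\<Sum>j<n. H' i j * w j)
        = (\<Sum>j<n. H i j * w j) - (\<Sum>j<n. \<Sum>b<k. c b * v b i * (w j * cnj (v b j)))"
      by (simp add: sum_subtractf)
    also have "(\<Sum>j<n. \<Sum>b<k. c b * v b i * (w j * cnj (v b j)))
        = (\<Sum>b<k. c b * v b i * (\<Sum>j<n. w j * cnj (v b j)))"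
      by (subst sum.swap) (simp add: sum_distrib_left)
    finally show ?thesis .
  qed
  have herm': "H' i j = cnj (H' j i)" if "i < n" "j < n" for i j
    using herm[OF that] unfolding H'_def by (simp add: c_cnj mult.commute mult.left_commute)
  have H'v: "(\<Sum>j<n. H' i j * v a j) = of_real s * v a i" if "a < k" "i < n" for a i
  proof -
    have "(\<Sum>b<k. c b * v b i * (\<Sum>j<n. v a j * cnj (v b j))) = (\<Sum>b<k. if a = b then c b * v b i else 0)"
      using on that by (intro sum.cong) auto
    also have "\<dots> = c a * v a i" using that by simp
    finally show ?thesis unfolding deflate using ev[OF that] by (simp add: c_def algebra_simps)
  qed
  define M where "M = mat n n (\<lambda>(i, j). H' i j)"
  have Mc: "M \<in> carrier_mat n n" by (simp add: M_def)
  have "mtrace M = (\<Sum>i<n. H' i i)" by (simp add: M_def mtrace_def)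
  also have "\<dots> = (\<Sum>i<n. H i i) - (\<Sum>i<n. \<Sum>a<k. c a * (v a i * cnj (v a i)))"
    by (simp add: H'_def sum_subtractf)
  also have "(\<Sum>i<n. \<Sum>a<k. c a * (v a i * cnj (v a i))) = (\<Sum>a<k. c a * (\<Sum>i<n. v a i * cnj (v a i)))"
    by (subst sum.swap) (simp add: sum_distrib_left)
  also have "\<dots> = (\<Sum>a<k. c a)"
    using on by (intro sum.cong) auto
  also have "(\<Sum>i<n. H i i) - (\<Sum>a<k. c a) = t + of_nat k * of_real s"
    unfolding t_def c_def by (simp add: sum_subtractf)
  finally have "mtrace M - of_nat n * of_real s = t - of_nat (n - k) * of_real s"
    using Suc.prems by (simp add: of_nat_diff algebra_simps)
  hence "mtrace M \<noteq> of_nat n * of_real s" using ts by auto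
  then obtain lam u where lam: "lam \<noteq> of_real s" and u: "u \<in> carrier_vec n" "u \<noteq> 0\<^sub>v n"
    and Mu: "M *\<^sub>v u = lam \<cdot>\<^sub>v u"
    using exists_eigenvector_neq[OF Mc] by metis
  have H'u: "(\<Sum>j<n. H' i j * u $ j) = lam * u $ i" if "i < n" for i
  proof -
    have "(M *\<^sub>v u) $ i = (\<Sum>j<n. H' i j * u $ j)"
      using that by (subst mat_mult_vec_index[OF Mc u(1)]) (auto simp: M_def)
    thus ?thesis using Mu u that by simp
  qed
  \<comment> \<open>Moving the Hermitian \<open>H'\<close> across the scalar product multiplies it
    by \<open>lam\<close> on one side and by the real number \<open>s\<close> on the other. Only
    \<open>s\<close> has to be real for this; \<open>lam\<close> is shown to be real later.\<close>
  have orth: "(\<Sum>i<n. u $ i * cnj (v a i)) = 0" if "a < k" for a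
  proof -
    have "lam * (\<Sum>i<n. u $ i * cnj (v a i)) = (\<Sum>i<n. (\<Sum>j<n. H' i j * u $ j) * cnj (v a i))"
      by (simp add: sum_distrib_left H'u mult.assoc)
    also have "\<dots> = (\<Sum>i<n. \<Sum>j<n. H' i j * u $ j * cnj (v a i))"
      by (simp add: sum_distrib_right)
    also have "\<dots> = (\<Sum>j<n. \<Sum>i<n. u $ j * cnj (H' j i * v a i))"
    proof (subst sum.swap, intro sum.cong refl)
      fix i j assume "j \<in> {..<n}" "i \<in> {..<n}"
      thus "H' i j * u $ j * cnj (v a i) = u $ j * cnj (H' j i * v a i)"
        using herm'[of i j] by simp
    qed
    also have "\<dots> = (\<Sum>j<n. u $ j * cnj (\<Sum>i<n. H' j i * v a i))"
      by (simp add: sum_distrib_left)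
    also have "\<dots> = of_real s * (\<Sum>i<n. u $ i * cnj (v a i))"
      by (simp add: H'v[OF that] sum_distrib_left mult_ac)
    finally show ?thesis using lam by simp
  qed
  \<comment> \<open>By orthogonality the subtracted rank-one terms vanish on \<open>u\<close>, which
    is therefore an eigenvector of \<open>H\<close> itself.\<close>
  have Hu: "(\<Sum>j<n. H i j * u $ j) = lam * u $ i" if "i < n" for i
    using deflate[of i "\<lambda>j. u $ j"] H'u[OF that] by (simp add: orth)
  define N where "N = (\<Sum>i<n. (cmod (u $ i))\<^sup>2)"
  obtain i0 where "i0 < n" "u $ i0 \<noteq> 0" using u by (metis eq_vecI carrier_vecD index_zero_vec)
  hence N0: "N > 0" unfolding N_def by (intro sum_pos2[of _ i0]) auto
  have uu: "(\<Sum>i<n. u $ i * cnj (u $ i)) = of_real N"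
    unfolding N_def by (simp add: complex_norm_square del: of_real_power)
  \<comment> \<open>The quadratic form of a Hermitian matrix is real, hence so is
    \<open>lam\<close>.\<close>
  have "lam * of_real N = (\<Sum>i<n. (\<Sum>j<n. H i j * u $ j) * cnj (u $ i))"
    unfolding uu[symmetric] by (simp add: sum_distrib_left Hu mult.assoc)
  also have "\<dots> = (\<Sum>i<n. \<Sum>j<n. H i j * u $ j * cnj (u $ i))"
    by (simp add: sum_distrib_right)
  also have "\<dots> = (\<Sum>j<n. \<Sum>i<n. cnj (H j i * u $ i * cnj (u $ j)))"
  proof (subst sum.swap, intro sum.cong refl)
    fix i j assume "j \<in> {..<n}" "i \<in> {..<n}"
    thus "H i j * u $ j * cnj (u $ i) = cnj (H j i * u $ i * cnj (u $ j))"
      using herm[of i j] by simp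
  qed
  also have "\<dots> = cnj (\<Sum>j<n. (\<Sum>i<n. H j i * u $ i) * cnj (u $ j))"
    by (simp add: sum_distrib_right)
  also have "\<dots> = cnj (lam * of_real N)"
    unfolding uu[symmetric] by (simp add: sum_distrib_left Hu mult.assoc)
  finally have "cnj lam = lam" using N0 by simp
  hence lamr: "lam = of_real (Re lam)" by (metis Reals_cnj_iff of_real_Re)
  define v' where "v' a i = (if a = k then u $ i / of_real (sqrt N) else v a i)" for a i
  define \<mu>' where "\<mu>' a = (if a = k then Re lam else \<mu> a)" for a
  have sN: "complex_of_real (sqrt N) * complex_of_real (sqrt N) = of_real N"
    using N0 by (simp flip: of_real_mult)
  have "(\<Sum>j<n. H i j * v' a j) = of_real (\<mu>' a) * v' a i" if "a < Suc k" "i < n" for a i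
  proof (cases "a = k")
    case True
    have "(\<Sum>j<n. H i j * (u $ j / of_real (sqrt N))) = (lam * u $ i) / of_real (sqrt N)"
      unfolding Hu[OF \<open>i < n\<close>, symmetric] by (simp add: sum_divide_distrib)
    thus ?thesis using True lamr by (simp add: v'_def \<mu>'_def)
  next
    case False
    thus ?thesis using that ev by (simp add: v'_def \<mu>'_def)
  qed
  moreover have "(\<Sum>i<n. v' a i * cnj (v' b i)) = (if a = b then 1 else 0)" if ab: "a < Suc k" "b < Suc k" for a b
  proof -
    have kk: "(\<Sum>i<n. (u $ i / of_real (sqrt N)) * cnj (u $ i / of_real (sqrt N))) = 1"
    proof -
      have "(\<Sum>i<n. (u $ i / of_real (sqrt N)) * cnj (u $ i / of_real (sqrt N)))
         = (\<Sum>i<n. u $ i * cnj (u $ i)) / (of_real (sqrt N) * of_real (sqrt N))"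
        by (simp add: sum_divide_distrib)
      thus ?thesis unfolding uu sN using N0 by simp
    qed
    have uv: "(\<Sum>i<n. (u $ i / of_real (sqrt N)) * cnj (v c i)) = 0" if "c < k" for c
      using orth[OF that] by (simp flip: sum_divide_distrib)
    have vu: "(\<Sum>i<n. v c i * cnj (u $ i / of_real (sqrt N))) = 0" if "c < k" for c
    proof -
      have "(\<Sum>i<n. v c i * cnj (u $ i / of_real (sqrt N))) = cnj (\<Sum>i<n. (u $ i / of_real (sqrt N)) * cnj (v c i))"
        by (simp add: mult.commute)
      thus ?thesis by (simp only: uv[OF that] complex_cnj_zero)
    qed
    consider "a = k" "b = k" | "a = k" "b < k" | "a < k" "b = k" | "a < k" "b < k"
      using ab by linarith
    thus ?thesis
      by cases (use kk uv vu on in \<open>simp_all add: v'_def\<close>)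
  qed
  ultimately show ?case by blast
qed

lemma proots_prod_list_linear:
  fixes xs :: "'a::idom list"
  shows "proots (\<Prod>a\<leftarrow>xs. [:- a, 1:]) = mset xs"
proof (induction xs)
  case (Cons a xs)
  have "(\<Prod>a\<leftarrow>xs. [:- a, 1:]) \<noteq> (0 :: 'a poly)" by (auto simp: prod_list_zero_iff)
  thus ?case using Cons by (simp add: proots_mult del: mult_pCons_left)
qed simp

text \<open>The hypothesis on \<open>W\<close> says that \<open>W\<^sup>\<dagger>\<close> is a contraction; it is used for the
  right singular vectors of \<open>X\<close>, an orthonormal eigenbasis of \<open>X\<^sup>\<dagger>X\<close>.\<close>

lemma norm_mtrace_mult_le_trace_norm:
  assumes W: "W \<in> carrier_mat n n" and X: "X \<in> carrier_mat n n"
    and contr: "\<And>x. (\<Sum>i<n. (cmod (\<Sum>j<n. cnj (W $$ (j, i)) * x j))\<^sup>2) \<le> (\<Sum>i<n. (cmod (x i))\<^sup>2)"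
  shows "cmod (mtrace (W * X)) \<le> trace_norm X"
proof -
  define H where "H i j = (\<Sum>k<n. cnj (X $$ (k, i)) * X $$ (k, j))" for i j
  have "H i j = cnj (H j i)" for i j by (simp add: H_def mult.commute)
  from hermitian_orthonormal_eigenvectors[of n H n, OF this]
  obtain v and \<mu> :: "nat \<Rightarrow> real" where
    "(\<forall>a<n. \<forall>i<n. (\<Sum>j<n. H i j * v a j) = of_real (\<mu> a) * v a i) \<and>
     (\<forall>a<n. \<forall>b<n. (\<Sum>i<n. v a i * cnj (v b i)) = (if a = b then 1 else 0))" by blast
  hence ev: "\<And>a i. a < n \<Longrightarrow> i < n \<Longrightarrow> (\<Sum>j<n. H i j * v a j) = of_real (\<mu> a) * v a i"
    and on: "\<And>a b. a < n \<Longrightarrow> b < n \<Longrightarrow> (\<Sum>i<n. v a i * cnj (v b i)) = (if a = b then 1 else 0)"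
    by blast+
  define V where "V = mat n n (\<lambda>(i, a). v a i)"
  define D where "D = mat n n (\<lambda>(i, a). if i = a then complex_of_real (\<mu> a) else 0)"
  define A where "A = mat_adjoint X * X"
  have c: "V \<in> carrier_mat n n" "D \<in> carrier_mat n n" "A \<in> carrier_mat n n"
    and Vc: "mat_adjoint V \<in> carrier_mat n n"
    using X by (auto simp: V_def D_def A_def intro!: mult_carrier_mat[of _ n n])
  have Aidx: "A $$ (i, j) = H i j" if "i < n" "j < n" for i j
    using that X unfolding A_def H_def
    by (subst mat_mult_index[of _ n n _ n]) (auto intro!: sum.cong)
  have VV: "mat_adjoint V * V = 1\<^sub>m n"
  proof (rule eq_matI)
    fix a b assume ab: "a < dim_row (1\<^sub>m n :: complex mat)" "b < dim_col (1\<^sub>m n :: complex mat)"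
    have "(mat_adjoint V * V) $$ (a, b) = (\<Sum>i<n. v b i * cnj (v a i))"
      using ab c Vc by (subst mat_mult_index[of _ n n _ n]) (auto simp: V_def mult.commute)
    thus "(mat_adjoint V * V) $$ (a, b) = 1\<^sub>m n $$ (a, b)" using on[of b a] ab by simp
  qed (use c Vc in auto)
  have VV': "V * mat_adjoint V = 1\<^sub>m n"
    by (rule mat_mult_left_right_inverse[OF Vc c(1) VV])
  have AV: "A * V = V * D"
  proof (rule eq_matI)
    fix i a assume ia: "i < dim_row (V * D)" "a < dim_col (V * D)"
    hence ia': "i < n" "a < n" using c by auto
    have "(A * V) $$ (i, a) = (\<Sum>j<n. H i j * v a j)"
      using ia' c by (subst mat_mult_index[of _ n n _ n]) (auto simp: V_def Aidx)
    also have "\<dots> = of_real (\<mu> a) * v a i" by (rule ev[OF ia'(2,1)])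
    also have "\<dots> = (V * D) $$ (i, a)"
      using ia' c by (subst mat_mult_index[of _ n n _ n]) (auto simp: V_def D_def if_distrib cong: if_cong)
    finally show "(A * V) $$ (i, a) = (V * D) $$ (i, a)" .
  qed (use c in auto)
  have "A = A * (V * mat_adjoint V)" using c VV' by simp
  also have "\<dots> = V * D * mat_adjoint V" using c Vc AV by (metis assoc_mult_mat)
  finally have AVD: "A = V * D * mat_adjoint V" .
  \<comment> \<open>Similarity identifies the roots in the definition of \<open>trace_norm\<close>,
    with multiplicities, as the numbers \<open>\<mu> a\<close>.\<close>
  have "similar_mat A D" by (rule similar_matI[OF _ VV' VV AVD]) (use c Vc in auto)
  hence "char_poly A = char_poly D" by (rule char_poly_similar)
  also have "\<dots> = (\<Prod>a\<leftarrow>diag_mat D. [:- a, 1:])"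
    by (rule char_poly_upper_triangular[OF c(2)]) (auto simp: D_def)
  finally have "proots (char_poly A) = mset (diag_mat D)"
    by (simp add: proots_prod_list_linear)
  also have "diag_mat D = map (\<lambda>a. complex_of_real (\<mu> a)) [0..<n]"
    by (auto simp: diag_mat_def D_def)
  finally have tn: "trace_norm X = (\<Sum>a<n. sqrt (\<mu> a))"
    unfolding trace_norm_def A_def[symmetric]
    by (simp add: sum_mset_sum_list sum_list_distinct_conv_sum_set atLeast0LessThan o_def image_mset.compositionality flip: mset_map)
  \<comment> \<open>\<open>y a\<close> is \<open>X\<close> applied to \<open>v a\<close>, and
    \<open>z a\<close> is the adjoint of \<open>W\<close> applied to \<open>v a\<close>; the trace
    is the sum of their scalar products. Leaving \<open>y a\<close> unnormalized avoids a division
    by \<open>sqrt (\<mu> a)\<close>, so vanishing singular values are covered as well.\<close>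
  define y where "y a i = (\<Sum>j<n. X $$ (i, j) * v a j)" for a i
  define z where "z a j = (\<Sum>i<n. cnj (W $$ (i, j)) * v a i)" for a j
  have y2: "(\<Sum>i<n. (cmod (y a i))\<^sup>2) = \<mu> a" if a: "a < n" for a
  proof -
    have Xy: "(\<Sum>i<n. cnj (X $$ (i, k)) * y a i) = (\<Sum>j<n. H k j * v a j)" for k
    proof -
      have "(\<Sum>i<n. cnj (X $$ (i, k)) * y a i) = (\<Sum>i<n. \<Sum>j<n. cnj (X $$ (i, k)) * X $$ (i, j) * v a j)"
        by (simp add: y_def sum_distrib_left mult.assoc)
      also have "\<dots> = (\<Sum>j<n. H k j * v a j)"
        by (subst sum.swap) (simp add: H_def sum_distrib_right)
      finally show ?thesis .
    qed
    have "complex_of_real (\<Sum>i<n. (cmod (y a i))\<^sup>2) = (\<Sum>i<n. y a i * cnj (y a i))"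
      by (simp add: complex_norm_square del: of_real_power)
    also have "\<dots> = (\<Sum>i<n. \<Sum>k<n. y a i * cnj (X $$ (i, k)) * cnj (v a k))"
      by (subst (2) y_def) (simp add: sum_distrib_left mult.assoc)
    also have "\<dots> = (\<Sum>k<n. (\<Sum>i<n. cnj (X $$ (i, k)) * y a i) * cnj (v a k))"
      by (subst sum.swap) (simp add: sum_distrib_left mult_ac)
    also have "\<dots> = (\<Sum>k<n. (\<Sum>j<n. H k j * v a j) * cnj (v a k))" by (simp only: Xy)
    also have "\<dots> = of_real (\<mu> a) * (\<Sum>k<n. v a k * cnj (v a k))"
      by (simp add: ev[OF a] sum_distrib_left mult.assoc)
    also have "\<dots> = of_real (\<mu> a)" using on[OF a a] by simp
    finally show ?thesis by (simp only: of_real_eq_iff)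
  qed
  have z2: "(\<Sum>i<n. (cmod (z a i))\<^sup>2) \<le> 1" if a: "a < n" for a
  proof -
    have "complex_of_real (\<Sum>i<n. (cmod (v a i))\<^sup>2) = (\<Sum>i<n. v a i * cnj (v a i))"
      by (simp add: complex_norm_square del: of_real_power)
    hence "(\<Sum>i<n. (cmod (v a i))\<^sup>2) = 1" using on[OF a a] by (metis of_real_eq_1_iff)
    thus ?thesis using contr[of "v a"] by (simp add: z_def)
  qed
  have "mtrace (W * X) = mtrace ((W * X) * (V * mat_adjoint V))" using W X VV' by simp
  also have "\<dots> = mtrace ((W * X * V) * mat_adjoint V)"
    using W X c Vc by (simp add: assoc_mult_mat[of _ n n _ n _ n])
  also have "\<dots> = mtrace (mat_adjoint V * (W * X * V))"
    using W X c Vc by (intro mtrace_mult_commute[of _ n n]) auto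
  also have "\<dots> = mtrace ((mat_adjoint V * W) * (X * V))"
    using W X c Vc by (simp add: assoc_mult_mat[of _ n n _ n _ n])
  also have "\<dots> = (\<Sum>a<n. \<Sum>i<n. cnj (z a i) * y a i)"
  proof -
    have "(mat_adjoint V * W) $$ (a, i) = cnj (z a i)" if "a < n" "i < n" for a i
      using that W Vc c by (subst mat_mult_index[of _ n n _ n]) (auto simp: z_def V_def mult.commute)
    moreover have "(X * V) $$ (i, a) = y a i" if "a < n" "i < n" for a i
      using that X c by (subst mat_mult_index[of _ n n _ n]) (auto simp: y_def V_def)
    moreover have "mtrace ((mat_adjoint V * W) * (X * V))
        = (\<Sum>a<n. \<Sum>i<n. (mat_adjoint V * W) $$ (a, i) * (X * V) $$ (i, a))"
      using W X c Vc
      by (subst mtrace_sum[of _ n]) (auto simp del: index_mult_mat(1) intro!: sum.cong mat_mult_index)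
    ultimately show ?thesis by simp
  qed
  finally have "cmod (mtrace (W * X)) \<le> (\<Sum>a<n. cmod (\<Sum>i<n. cnj (z a i) * y a i))"
    by (simp add: norm_sum)
  also have "\<dots> \<le> (\<Sum>a<n. sqrt (\<mu> a))"
  proof (rule sum_mono)
    fix a assume "a \<in> {..<n}"
    hence a: "a < n" by simp
    have "cmod (\<Sum>i<n. cnj (z a i) * y a i) \<le> (\<Sum>i<n. cmod (z a i) * cmod (y a i))"
      by (rule order_trans[OF norm_sum]) (simp add: norm_mult)
    also have "\<dots> \<le> L2_set (\<lambda>i. cmod (z a i)) {..<n} * L2_set (\<lambda>i. cmod (y a i)) {..<n}"
      using L2_set_mult_ineq[of "\<lambda>i. cmod (z a i)" "\<lambda>i. cmod (y a i)"] by simp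
    also have "\<dots> \<le> 1 * sqrt (\<mu> a)"
      unfolding L2_set_def y2[OF a]
      by (intro mult_mono) (use z2[OF a] in \<open>auto simp flip: y2[OF a] intro: sum_nonneg\<close>)
    also have "\<dots> = sqrt (\<mu> a)" by simp
    finally show "cmod (\<Sum>i<n. cnj (z a i) * y a i) \<le> sqrt (\<mu> a)" .
  qed
  finally show ?thesis unfolding tn .
qed

section \<open>Tensor products\<close>

lemma kron_carrier [simp]:
  "X \<in> carrier_mat a b \<Longrightarrow> Y \<in> carrier_mat c d \<Longrightarrow> kron X Y \<in> carrier_mat (a * c) (b * d)"
  by (auto simp: kron_def)

lemma kron_index:
  assumes "X \<in> carrier_mat a b" "Y \<in> carrier_mat c d" "i < a" "j < b" "i' < c" "j' < d"
  shows "kron X Y $$ (i * c + i', j * d + j') = X $$ (i, j) * Y $$ (i', j')"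
  using assms mult_add_less[of i a i' c] mult_add_less[of j b j' d] by (auto simp: kron_def)

text \<open>Division with remainder writes every index as a pair, so that entries are compared in
  the form to which \<open>kron_index\<close> applies, free of \<open>div\<close> and
  \<open>mod\<close>.\<close>

lemma eq_mat_tensorI:
  assumes "A \<in> carrier_mat (a * c) (b * d)" "B \<in> carrier_mat (a * c) (b * d)"
    and eq: "\<And>i i' j j'. i < a \<Longrightarrow> i' < c \<Longrightarrow> j < b \<Longrightarrow> j' < d \<Longrightarrow>
      A $$ (i * c + i', j * d + j') = B $$ (i * c + i', j * d + j')"
  shows "A = B"
proof (rule eq_matI)
  fix k l assume "k < dim_row B" "l < dim_col B"
  hence "k < a * c" "l < b * d" using assms by auto
  hence "k div c < a" "k mod c < c" "l div d < b" "l mod d < d"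
    by (auto simp: less_mult_imp_div_less intro!: mod_less_divisor gr0I)
  from eq[OF this] show "A $$ (k, l) = B $$ (k, l)" by simp
qed (use assms in auto)

lemma kron_mult_kron:
  assumes "X \<in> carrier_mat a b" "Y \<in> carrier_mat a' b'" "Z \<in> carrier_mat b c" "V \<in> carrier_mat b' c'"
  shows "kron X Y * kron Z V = kron (X * Z) (Y * V)"
proof (rule eq_mat_tensorI)
  fix i i' j j' assume ij: "i < a" "i' < a'" "j < c" "j' < c'"
  have "(kron X Y * kron Z V) $$ (i * a' + i', j * c' + j')
      = (\<Sum>k<b. \<Sum>k'<b'. kron X Y $$ (i * a' + i', k * b' + k') * kron Z V $$ (k * b' + k', j * c' + j'))"
    using assms ij by (subst mat_mult_index[OF kron_carrier kron_carrier])
      (auto simp: sum_lessThan_mult mult_add_less)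
  also have "\<dots> = (\<Sum>k<b. \<Sum>k'<b'. (X $$ (i, k) * Z $$ (k, j)) * (Y $$ (i', k') * V $$ (k', j')))"
    by (intro sum.cong refl, simp only: kron_index[OF assms(1,2)] kron_index[OF assms(3,4)] ij lessThan_iff)
      (simp add: mult_ac)
  also have "\<dots> = (X * Z) $$ (i, j) * (Y * V) $$ (i', j')"
    using ij by (simp only: mat_mult_index[OF assms(1,3)] mat_mult_index[OF assms(2,4)] sum_product)
  also have "\<dots> = kron (X * Z) (Y * V) $$ (i * a' + i', j * c' + j')"
    using ij assms by (subst kron_index[of _ a c _ a' c']) (auto intro: mult_carrier_mat)
  finally show "(kron X Y * kron Z V) $$ (i * a' + i', j * c' + j')
      = kron (X * Z) (Y * V) $$ (i * a' + i', j * c' + j')" .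
qed (use assms in \<open>auto intro!: mult_carrier_mat kron_carrier\<close>)

lemma mtrace_kron:
  assumes "X \<in> carrier_mat a a" "Y \<in> carrier_mat b b"
  shows "mtrace (kron X Y) = mtrace X * mtrace Y"
  using assms
  by (simp add: mtrace_sum[OF kron_carrier[OF assms]] mtrace_sum[OF assms(1)] mtrace_sum[OF assms(2)]
      sum_lessThan_mult kron_index[OF assms] sum_product)

lemma kron_one: "kron (1\<^sub>m a) (1\<^sub>m b) = 1\<^sub>m (a * b)"
proof (rule eq_mat_tensorI)
  fix i i' j j' assume ij: "i < a" "i' < b" "j < a" "j' < b"
  have "i * b + i' = j * b + j' \<longleftrightarrow> i = j \<and> i' = j'"
  proof
    assume eq: "i * b + i' = j * b + j'"
    have "i = (i * b + i') div b" "i' = (i * b + i') mod b" "j = (j * b + j') div b" "j' = (j * b + j') mod b"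
      using ij by auto
    thus "i = j \<and> i' = j'" using eq by metis
  qed auto
  thus "kron (1\<^sub>m a) (1\<^sub>m b) $$ (i * b + i', j * b + j') = (1\<^sub>m (a * b) :: complex mat) $$ (i * b + i', j * b + j')"
    using ij by (subst kron_index[of _ a a _ b b]) (auto simp: mult_add_less)
qed auto

lemma basis_op_carrier [simp]: "basis_op n i j \<in> carrier_mat n n"
  by (simp add: basis_op_def)

lemma basis_op_index:
  "k < n \<Longrightarrow> l < n \<Longrightarrow> basis_op n i j $$ (k, l) = (if k = i \<and> l = j then 1 else 0)"
  by (simp add: basis_op_def)

lemma linear_mapD:
  assumes "linear_map a b T"
  shows "X \<in> carrier_mat a a \<Longrightarrow> T X \<in> carrier_mat b b"
    and "X \<in> carrier_mat a a \<Longrightarrow> Y \<in> carrier_mat a a \<Longrightarrow> T (X + Y) = T X + T Y"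
    and "X \<in> carrier_mat a a \<Longrightarrow> T (c \<cdot>\<^sub>m X) = c \<cdot>\<^sub>m T X"
  using assms unfolding linear_map_def by blast+

text \<open>\<open>T\<close> is an opaque function, additive on pairs of matrices of the carrier, so
  the matrix units are added one at a time: \<open>part S\<close> keeps the entries of
  \<open>X\<close> at the positions in \<open>S\<close>.\<close>

lemma linear_map_expand:
  assumes T: "linear_map a b T" and X: "X \<in> carrier_mat a a" and kl: "k < b" "l < b"
  shows "T X $$ (k, l) = (\<Sum>i<a. \<Sum>j<a. X $$ (i, j) * T (basis_op a i j) $$ (k, l))"
proof -
  define part where "part S = mat a a (\<lambda>p. if p \<in> S then X $$ p else 0)" for S
  have pc: "part S \<in> carrier_mat a a" for S by (simp add: part_def)
  have "T (part S) $$ (k, l) = (\<Sum>p\<in>S. X $$ p * T (basis_op a (fst p) (snd p)) $$ (k, l))"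
    if "finite S" "S \<subseteq> {..<a} \<times> {..<a}" for S
    using that
  proof (induction S rule: finite_induct)
    case empty
    \<comment> \<open>The zero matrix is 0 times itself, so homogeneity makes its image
      zero.\<close>
    have "part {} = 0 \<cdot>\<^sub>m part {}" by (intro eq_matI) (auto simp: part_def)
    hence eq: "T (part {}) = 0 \<cdot>\<^sub>m T (part {})" using linear_mapD(3)[OF T pc, of 0 "{}"] by simp
    have "T (part {}) \<in> carrier_mat b b" by (rule linear_mapD(1)[OF T pc])
    thus ?case by (subst eq) (use kl in auto)
  next
    case (insert p S)
    let ?E = "basis_op a (fst p) (snd p)"
    have "part (insert p S) = part S + X $$ p \<cdot>\<^sub>m ?E"
      using insert by (intro eq_matI) (auto simp: part_def basis_op_def)
    hence "T (part (insert p S)) = T (part S) + X $$ p \<cdot>\<^sub>m T ?E"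
      by (simp add: linear_mapD(2,3)[OF T] pc)
    thus ?case using insert linear_mapD(1)[OF T pc, of S] linear_mapD(1)[OF T, of ?E] kl
      by (auto simp: add.commute)
  qed
  from this[of "{..<a} \<times> {..<a}"]
  have "T (part ({..<a} \<times> {..<a})) $$ (k, l)
      = (\<Sum>i<a. \<Sum>j<a. X $$ (i, j) * T (basis_op a i j) $$ (k, l))"
    by (simp add: sum.cartesian_product case_prod_beta)
  moreover have "part ({..<a} \<times> {..<a}) = X" using X by (intro eq_matI) (auto simp: part_def)
  ultimately show ?thesis by simp
qed

lemma tensor_map_carrier [simp]: "tensor_map a b S a' b' T X \<in> carrier_mat (b * b') (b * b')"
  by (simp add: tensor_map_def)

lemma tensor_map_index:
  assumes S: "linear_map a b S" and T: "linear_map a' b' T" and "k < b" "l < b" "k' < b'" "l' < b'"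
  shows "tensor_map a b S a' b' T X $$ (k * b' + k', l * b' + l') =
    (\<Sum>i<a. \<Sum>j<a. \<Sum>i'<a'. \<Sum>j'<a'. X $$ (i * a' + i', j * a' + j') *
      (S (basis_op a i j) $$ (k, l) * T (basis_op a' i' j') $$ (k', l')))"
  using assms by (simp add: tensor_map_def mult_add_less
      kron_index[OF linear_mapD(1)[OF S basis_op_carrier] linear_mapD(1)[OF T basis_op_carrier]])

lemma linear_map_tensor_map: "linear_map (a * a') (b * b') (tensor_map a b S a' b' T)"
  unfolding linear_map_def
proof (intro conjI ballI allI)
  fix X Y :: "complex mat" assume XY: "X \<in> carrier_mat (a * a') (a * a')" "Y \<in> carrier_mat (a * a') (a * a')"
  show "tensor_map a b S a' b' T (X + Y) = tensor_map a b S a' b' T X + tensor_map a b S a' b' T Y"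
    using XY by (intro eq_matI)
      (auto simp: tensor_map_def mult_add_less distrib_right sum.distrib intro!: sum.cong)
next
  fix c and X :: "complex mat" assume X: "X \<in> carrier_mat (a * a') (a * a')"
  show "tensor_map a b S a' b' T (c \<cdot>\<^sub>m X) = c \<cdot>\<^sub>m tensor_map a b S a' b' T X"
    using X by (intro eq_matI)
      (auto simp: tensor_map_def mult_add_less sum_distrib_left mult.assoc intro!: sum.cong)
qed simp

lemma linear_map_id: "linear_map a a id"
  by (simp add: linear_map_def)

lemma tensor_map_kron:
  assumes S: "linear_map a b S" and T: "linear_map a' b' T"
    and X: "X \<in> carrier_mat a a" and Y: "Y \<in> carrier_mat a' a'"
  shows "tensor_map a b S a' b' T (kron X Y) = kron (S X) (T Y)"
proof (rule eq_mat_tensorI)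
  fix k k' l l' assume kl: "k < b" "k' < b'" "l < b" "l' < b'"
  have "tensor_map a b S a' b' T (kron X Y) $$ (k * b' + k', l * b' + l') =
    (\<Sum>i<a. \<Sum>j<a. \<Sum>i'<a'. \<Sum>j'<a'. X $$ (i, j) * Y $$ (i', j') *
      (S (basis_op a i j) $$ (k, l) * T (basis_op a' i' j') $$ (k', l')))"
    using kl by (subst tensor_map_index[OF S T]) (auto simp: kron_index[OF X Y])
  also have "\<dots> = (\<Sum>i<a. \<Sum>j<a. \<Sum>i'<a'. \<Sum>j'<a'. (X $$ (i, j) * S (basis_op a i j) $$ (k, l)) *
      (Y $$ (i', j') * T (basis_op a' i' j') $$ (k', l')))"
    by (simp add: mult_ac)
  also have "\<dots> = S X $$ (k, l) * T Y $$ (k', l')"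
    using kl by (simp add: linear_map_expand[OF S X] linear_map_expand[OF T Y]
        sum_distrib_left[symmetric] sum_distrib_right[symmetric])
  also have "\<dots> = kron (S X) (T Y) $$ (k * b' + k', l * b' + l')"
    using kl by (simp add: kron_index[OF linear_mapD(1)[OF S X] linear_mapD(1)[OF T Y]])
  finally show "tensor_map a b S a' b' T (kron X Y) $$ (k * b' + k', l * b' + l')
    = kron (S X) (T Y) $$ (k * b' + k', l * b' + l')" .
qed (use linear_mapD(1)[OF S X] linear_mapD(1)[OF T Y] in auto)

text \<open>The identity leaves the matrix units of the ancilla unchanged, so a single pair
  \<open>i'\<close>, \<open>j'\<close> survives and the ancilla indices are merely carried
  along.\<close>

lemma tensor_id_index:
  assumes S: "linear_map a b S" and "k < b" "l < b" "k' < c" "l' < c"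
  shows "tensor_id a b S c X $$ (k * c + k', l * c + l') =
    (\<Sum>i<a. \<Sum>j<a. X $$ (i * c + k', j * c + l') * S (basis_op a i j) $$ (k, l))"
proof -
  have "(\<Sum>i'<c. \<Sum>j'<c. X $$ (i * c + i', j * c + j') * (s * id (basis_op c i' j') $$ (k', l')))
    = X $$ (i * c + k', j * c + l') * s" for i j s
  proof -
    have "(\<Sum>i'<c. \<Sum>j'<c. X $$ (i * c + i', j * c + j') * (s * id (basis_op c i' j') $$ (k', l')))
      = (\<Sum>i'<c. \<Sum>j'<c. if j' = l' then (if i' = k' then X $$ (i * c + i', j * c + j') * s else 0) else 0)"
      using assms by (intro sum.cong refl) (auto simp: basis_op_index)
    thus ?thesis using assms by simp
  qed
  thus ?thesis using assms by (subst tensor_map_index[OF S linear_map_id]) auto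
qed

text \<open>A trivial ancilla brings statements about extensions back to the map itself: positivity
  from complete positivity, and a lower bound on the diamond distance.\<close>

lemma tensor_id_one:
  assumes S: "linear_map a b S" and X: "X \<in> carrier_mat a a"
  shows "tensor_id a b S 1 X = S X"
proof (rule eq_matI)
  fix k l assume "k < dim_row (S X)" "l < dim_col (S X)"
  hence "k < b" "l < b" using linear_mapD(1)[OF S X] by auto
  thus "tensor_id a b S 1 X $$ (k, l) = S X $$ (k, l)"
    using tensor_id_index[OF S, of k l 0 1 0 X] linear_map_expand[OF S X] by simp
qed (use linear_mapD(1)[OF S X] tensor_map_carrier[of a b S 1 1 id X] in auto)

lemma max_coh_state_eq: "max_coh_state d = mat d d (\<lambda>_. 1 / of_nat d)"
proof (rule eq_matI)
  fix i j assume "i < dim_row (mat d d (\<lambda>_. 1 / of_nat d :: complex))"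
    "j < dim_col (mat d d (\<lambda>_. 1 / of_nat d :: complex))"
  moreover have "complex_of_real (1 / sqrt (real d)) * cnj (complex_of_real (1 / sqrt (real d))) = 1 / of_nat d"
    by (simp flip: of_real_mult)
  ultimately show "max_coh_state d $$ (i, j) = mat d d (\<lambda>_. 1 / of_nat d) $$ (i, j)"
    by (simp add: max_coh_state_def ket_bra_def max_coh_vec_def)
qed (simp_all add: max_coh_state_def ket_bra_def max_coh_vec_def)

lemma max_coh_state_carrier [simp]: "max_coh_state d \<in> carrier_mat d d"
  by (simp add: max_coh_state_eq)

text \<open>Uniform amplitudes multiply to uniform amplitudes. This merges the input with the
  coherent resource, and it splits the input into single copies.\<close>

lemma kron_max_coh_state: "kron (max_coh_state a) (max_coh_state b) = max_coh_state (a * b)"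
proof (rule eq_mat_tensorI)
  fix i i' j j' assume "i < a" "i' < b" "j < a" "j' < b"
  thus "kron (max_coh_state a) (max_coh_state b) $$ (i * b + i', j * b + j')
      = max_coh_state (a * b) $$ (i * b + i', j * b + j')"
    by (subst kron_index[of _ a a _ b b]) (auto simp: max_coh_state_eq mult_add_less)
qed auto

section \<open>Completely positive maps\<close>

text \<open>Test vectors become arbitrary functions of the index, which can be given as sums without
  carrier conditions.\<close>

lemma psd_iff:
  "psd n X \<longleftrightarrow> X \<in> carrier_mat n n \<and> (\<forall>f. 0 \<le> (\<Sum>i<n. \<Sum>j<n. X $$ (i, j) * f j * cnj (f i)))"
proof -
  have form: "(X *\<^sub>v v) \<bullet>c v = (\<Sum>i<n. \<Sum>j<n. X $$ (i, j) * v $ j * cnj (v $ i))"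
    if "X \<in> carrier_mat n n" "v \<in> carrier_vec n" for v
    using that by (simp add: cscalar_prod_sum[OF that(2)] mat_mult_vec_index[OF that] sum_distrib_right
        del: index_mult_mat_vec)
  have "(\<forall>v\<in>carrier_vec n. 0 \<le> (\<Sum>i<n. \<Sum>j<n. X $$ (i, j) * v $ j * cnj (v $ i))) \<longleftrightarrow>
      (\<forall>f. 0 \<le> (\<Sum>i<n. \<Sum>j<n. X $$ (i, j) * f j * cnj (f i)))"
  proof (intro iffI allI ballI)
    fix f assume *: "\<forall>v\<in>carrier_vec n. 0 \<le> (\<Sum>i<n. \<Sum>j<n. X $$ (i, j) * v $ j * cnj (v $ i))"
    have "0 \<le> (\<Sum>i<n. \<Sum>j<n. X $$ (i, j) * vec n f $ j * cnj (vec n f $ i))"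
      using * vec_carrier by blast
    thus "0 \<le> (\<Sum>i<n. \<Sum>j<n. X $$ (i, j) * f j * cnj (f i))" by simp
  qed blast
  thus ?thesis unfolding psd_def by (intro conj_cong refl) (simp add: form)
qed

lemma sum_swap_pairs:
  fixes g :: "'a \<Rightarrow> 'b \<Rightarrow> 'c \<Rightarrow> 'd \<Rightarrow> 'e::comm_monoid_add"
  shows "(\<Sum>i\<in>A. \<Sum>j\<in>B. \<Sum>k\<in>C. \<Sum>l\<in>D. g i j k l) = (\<Sum>k\<in>C. \<Sum>l\<in>D. \<Sum>i\<in>A. \<Sum>j\<in>B. g i j k l)"
proof -
  have "(\<Sum>i\<in>A. \<Sum>j\<in>B. \<Sum>k\<in>C. \<Sum>l\<in>D. g i j k l) = (\<Sum>i\<in>A. \<Sum>k\<in>C. \<Sum>j\<in>B. \<Sum>l\<in>D. g i j k l)"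
    by (intro sum.cong refl sum.swap)
  also have "\<dots> = (\<Sum>k\<in>C. \<Sum>i\<in>A. \<Sum>j\<in>B. \<Sum>l\<in>D. g i j k l)"
    by (rule sum.swap)
  also have "\<dots> = (\<Sum>k\<in>C. \<Sum>i\<in>A. \<Sum>l\<in>D. \<Sum>j\<in>B. g i j k l)"
    by (intro sum.cong refl sum.swap)
  also have "\<dots> = (\<Sum>k\<in>C. \<Sum>l\<in>D. \<Sum>i\<in>A. \<Sum>j\<in>B. g i j k l)"
    by (intro sum.cong refl sum.swap)
  finally show ?thesis .
qed

text \<open>\<open>Y\<close> is a sum of matrices \<open>X\<close> sandwiched between
  \<open>L r\<close> and its adjoint. Its quadratic form at \<open>f\<close> is the sum of those of
  \<open>X\<close> at the vectors \<open>g r\<close>, the adjoint of \<open>L r\<close> applied to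
  \<open>f\<close>.\<close>

lemma psd_kraus:
  assumes X: "psd N X" and Y: "Y \<in> carrier_mat n n"
    and eq: "\<And>k l. k < n \<Longrightarrow> l < n \<Longrightarrow>
      Y $$ (k, l) = (\<Sum>r<R. \<Sum>p<N. \<Sum>q<N. X $$ (p, q) * (L r k p * cnj (L r l q)))"
  shows "psd n Y"
  unfolding psd_iff
proof (intro conjI Y allI)
  fix f :: "nat \<Rightarrow> complex"
  define g where "g r q = (\<Sum>l<n. cnj (L r l q) * f l)" for r q
  have r: "(\<Sum>k<n. \<Sum>l<n. (\<Sum>p<N. \<Sum>q<N. X $$ (p, q) * (L r k p * cnj (L r l q))) * f l * cnj (f k))
      = (\<Sum>p<N. \<Sum>q<N. X $$ (p, q) * g r q * cnj (g r p))" for r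
  proof -
    have "(\<Sum>k<n. \<Sum>l<n. (\<Sum>p<N. \<Sum>q<N. X $$ (p, q) * (L r k p * cnj (L r l q))) * f l * cnj (f k))
      = (\<Sum>k<n. \<Sum>l<n. \<Sum>p<N. \<Sum>q<N. X $$ (p, q) * (L r k p * cnj (f k) * (cnj (L r l q) * f l)))"
      by (simp add: sum_distrib_left mult_ac)
    also have "\<dots> = (\<Sum>p<N. \<Sum>q<N. \<Sum>k<n. \<Sum>l<n. X $$ (p, q) * (L r k p * cnj (f k) * (cnj (L r l q) * f l)))"
      by (rule sum_swap_pairs)
    also have "\<dots> = (\<Sum>p<N. \<Sum>q<N. X $$ (p, q) * ((\<Sum>k<n. L r k p * cnj (f k)) * (\<Sum>l<n. cnj (L r l q) * f l)))"
      unfolding sum_product by (simp only: sum_distrib_left)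
    also have "\<dots> = (\<Sum>p<N. \<Sum>q<N. X $$ (p, q) * g r q * cnj (g r p))"
      by (simp add: g_def mult_ac)
    finally show ?thesis .
  qed
  have "(\<Sum>k<n. \<Sum>l<n. Y $$ (k, l) * f l * cnj (f k))
      = (\<Sum>k<n. \<Sum>l<n. \<Sum>r<R. (\<Sum>p<N. \<Sum>q<N. X $$ (p, q) * (L r k p * cnj (L r l q))) * f l * cnj (f k))"
    by (simp add: eq sum_distrib_right)
  also have "\<dots> = (\<Sum>k<n. \<Sum>r<R. \<Sum>l<n. (\<Sum>p<N. \<Sum>q<N. X $$ (p, q) * (L r k p * cnj (L r l q))) * f l * cnj (f k))"
    by (intro sum.cong refl sum.swap)
  also have "\<dots> = (\<Sum>r<R. \<Sum>k<n. \<Sum>l<n. (\<Sum>p<N. \<Sum>q<N. X $$ (p, q) * (L r k p * cnj (L r l q))) * f l * cnj (f k))"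
    by (rule sum.swap)
  also have "\<dots> = (\<Sum>r<R. \<Sum>p<N. \<Sum>q<N. X $$ (p, q) * g r q * cnj (g r p))"
    by (simp only: r)
  finally have "(\<Sum>k<n. \<Sum>l<n. Y $$ (k, l) * f l * cnj (f k))
      = (\<Sum>r<R. \<Sum>p<N. \<Sum>q<N. X $$ (p, q) * g r q * cnj (g r p))" .
  moreover have "0 \<le> (\<Sum>p<N. \<Sum>q<N. X $$ (p, q) * g r q * cnj (g r p))" for r
    using X unfolding psd_iff by blast
  hence "0 \<le> (\<Sum>r<R. \<Sum>p<N. \<Sum>q<N. X $$ (p, q) * g r q * cnj (g r p))"
    by (rule sum_nonneg)
  ultimately show "0 \<le> (\<Sum>k<n. \<Sum>l<n. Y $$ (k, l) * f l * cnj (f k))" by simp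
qed

text \<open>The conditional is the identity matrix of the ancilla, whose sum collapses.\<close>

lemma sum_delta_kron:
  fixes f :: "nat \<Rightarrow> 'a::comm_semiring_1"
  assumes "y mod c < c"
  shows "(\<Sum>p<a * c. f p * (if p mod c = y mod c then g (p div c) else 0)) = (\<Sum>i<a. f (i * c + y mod c) * g i)"
  using assms by (simp add: sum_lessThan_mult if_distrib cong: if_cong)

text \<open>\<open>M\<close> lists the entries of the Choi matrix. Its factorization provides Kraus
  operators \<open>G r\<close>; tensored with the identity they are Kraus operators of the extended
  map, so \<open>psd_kraus\<close> applies. The last hypothesis is trace preservation on matrix
  units.\<close>

lemma cptp_choiI:
  assumes T: "\<And>X. X \<in> carrier_mat a a \<Longrightarrow>
      T X = mat b b (\<lambda>(k, l). \<Sum>i<a. \<Sum>j<a. X $$ (i, j) * M i j k l)"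
    and M: "\<And>i j k l. i < a \<Longrightarrow> j < a \<Longrightarrow> k < b \<Longrightarrow> l < b \<Longrightarrow>
      M i j k l = (\<Sum>r<R. G r k i * cnj (G r l j))"
    and tr: "\<And>i j. i < a \<Longrightarrow> j < a \<Longrightarrow> (\<Sum>k<b. M i j k k) = (if i = j then 1 else 0)"
  shows "cptp a b T"
proof -
  have lin: "linear_map a b T"
    unfolding linear_map_def
  proof (intro conjI ballI allI)
    fix X Y :: "complex mat" assume XY: "X \<in> carrier_mat a a" "Y \<in> carrier_mat a a"
    show "T (X + Y) = T X + T Y"
      using XY by (intro eq_matI) (auto simp: T distrib_right sum.distrib)
  next
    fix c and X :: "complex mat" assume X: "X \<in> carrier_mat a a"
    show "T (c \<cdot>\<^sub>m X) = c \<cdot>\<^sub>m T X"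
      using X by (intro eq_matI) (auto simp: T sum_distrib_left mult.assoc)
  qed (simp add: T)
  have TE: "T (basis_op a i j) $$ (k, l) = M i j k l" if "i < a" "j < a" "k < b" "l < b" for i j k l
  proof -
    have "T (basis_op a i j) $$ (k, l) = (\<Sum>i'<a. \<Sum>j'<a. basis_op a i j $$ (i', j') * M i' j' k l)"
      using that by (simp add: T)
    also have "\<dots> = (\<Sum>i'<a. \<Sum>j'<a. if j' = j then (if i' = i then M i' j' k l else 0) else 0)"
      by (intro sum.cong refl) (auto simp: basis_op_index)
    finally show ?thesis using that by simp
  qed
  have "psd (b * c) (tensor_id a b T c X)" if X: "psd (a * c) X" for c X
  proof (rule psd_kraus[OF X tensor_map_carrier])
    fix k l assume kl: "k < b * c" "l < b * c"
    hence kl': "k div c < b" "k mod c < c" "l div c < b" "l mod c < c"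
      by (auto simp: less_mult_imp_div_less intro!: mod_less_divisor gr0I)
    define L where "L r k p = (if p mod c = k mod c then G r (k div c) (p div c) else 0)" for r k p
    have cL: "cnj (L r k p) = (if p mod c = k mod c then cnj (G r (k div c) (p div c)) else 0)" for r k p
      by (simp add: L_def)
    have r: "(\<Sum>p<a * c. \<Sum>q<a * c. X $$ (p, q) * (L r k p * cnj (L r l q)))
        = (\<Sum>i<a. \<Sum>j<a. X $$ (i * c + k mod c, j * c + l mod c) * (G r (k div c) i * cnj (G r (l div c) j)))" for r
    proof -
      have "(\<Sum>p<a * c. \<Sum>q<a * c. X $$ (p, q) * (L r k p * cnj (L r l q)))
        = (\<Sum>p<a * c. (\<Sum>q<a * c. X $$ (p, q) * cnj (L r l q)) * L r k p)"
        by (simp add: sum_distrib_left mult_ac)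
      also have "\<dots> = (\<Sum>p<a * c. (\<Sum>j<a. X $$ (p, j * c + l mod c) * cnj (G r (l div c) j)) * L r k p)"
        unfolding cL by (simp only: sum_delta_kron[OF kl'(4), where g = "\<lambda>j. cnj (G r (l div c) j)"])
      also have "\<dots> = (\<Sum>i<a. (\<Sum>j<a. X $$ (i * c + k mod c, j * c + l mod c) * cnj (G r (l div c) j)) * G r (k div c) i)"
        unfolding L_def by (simp only: sum_delta_kron[OF kl'(2), where g = "\<lambda>i. G r (k div c) i"])
      also have "\<dots> = (\<Sum>i<a. \<Sum>j<a. X $$ (i * c + k mod c, j * c + l mod c) * (G r (k div c) i * cnj (G r (l div c) j)))"
        by (simp add: sum_distrib_left mult_ac)
      finally show ?thesis .
    qed
    have "tensor_id a b T c X $$ (k, l)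
        = (\<Sum>i<a. \<Sum>j<a. X $$ (i * c + k mod c, j * c + l mod c) * T (basis_op a i j) $$ (k div c, l div c))"
      using tensor_id_index[OF lin kl'(1,3,2,4), of X] by simp
    also have "\<dots> = (\<Sum>i<a. \<Sum>j<a. \<Sum>r<R. X $$ (i * c + k mod c, j * c + l mod c) * (G r (k div c) i * cnj (G r (l div c) j)))"
      using kl' by (simp add: TE M sum_distrib_left)
    also have "\<dots> = (\<Sum>i<a. \<Sum>r<R. \<Sum>j<a. X $$ (i * c + k mod c, j * c + l mod c) * (G r (k div c) i * cnj (G r (l div c) j)))"
      by (intro sum.cong refl sum.swap)
    also have "\<dots> = (\<Sum>r<R. \<Sum>i<a. \<Sum>j<a. X $$ (i * c + k mod c, j * c + l mod c) * (G r (k div c) i * cnj (G r (l div c) j)))"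
      by (rule sum.swap)
    finally show "tensor_id a b T c X $$ (k, l) = (\<Sum>r<R. \<Sum>p<a * c. \<Sum>q<a * c. X $$ (p, q) *
       ((if p mod c = k mod c then G r (k div c) (p div c) else 0) *
        cnj (if q mod c = l mod c then G r (l div c) (q div c) else 0)))"
      unfolding r[symmetric] L_def .
  qed
  moreover have "mtrace (T X) = mtrace X" if X: "X \<in> carrier_mat a a" for X
  proof -
    have "mtrace (T X) = (\<Sum>k<b. \<Sum>i<a. \<Sum>j<a. X $$ (i, j) * M i j k k)"
      using X by (simp add: mtrace_def T)
    also have "\<dots> = (\<Sum>i<a. \<Sum>k<b. \<Sum>j<a. X $$ (i, j) * M i j k k)" by (rule sum.swap)
    also have "\<dots> = (\<Sum>i<a. \<Sum>j<a. \<Sum>k<b. X $$ (i, j) * M i j k k)" by (intro sum.cong refl sum.swap)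
    also have "\<dots> = (\<Sum>i<a. \<Sum>j<a. if i = j then X $$ (i, j) else 0)"
      by (intro sum.cong refl) (auto simp: sum_distrib_left[symmetric] tr)
    also have "\<dots> = mtrace X" using X by (simp add: mtrace_sum)
    finally show ?thesis .
  qed
  ultimately show ?thesis unfolding cptp_def using lin by blast
qed

lemma mtrace_tensor_id:
  assumes T: "cptp a b T" and X: "X \<in> carrier_mat (a * c) (a * c)"
  shows "mtrace (tensor_id a b T c X) = mtrace X"
proof -
  have lin: "linear_map a b T" using T by (simp add: cptp_def)
  have tr: "(\<Sum>k<b. T (basis_op a i j) $$ (k, k)) = (if i = j then 1 else 0)" if "i < a" "j < a" for i j
  proof -
    have "(\<Sum>k<b. T (basis_op a i j) $$ (k, k)) = mtrace (T (basis_op a i j))"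
      by (rule mtrace_sum[symmetric]) (rule linear_mapD(1)[OF lin basis_op_carrier])
    also have "\<dots> = mtrace (basis_op a i j)" using T by (simp add: cptp_def)
    also have "\<dots> = (if i = j then 1 else 0)"
      using that by (auto simp: mtrace_sum[OF basis_op_carrier] basis_op_index)
    finally show ?thesis .
  qed
  have "mtrace (tensor_id a b T c X) =
      (\<Sum>k<b. \<Sum>x<c. \<Sum>i<a. \<Sum>j<a. X $$ (i * c + x, j * c + x) * T (basis_op a i j) $$ (k, k))"
    by (simp add: mtrace_sum[OF tensor_map_carrier] sum_lessThan_mult tensor_id_index[OF lin])
  also have "\<dots> = (\<Sum>i<a. \<Sum>j<a. \<Sum>k<b. \<Sum>x<c. X $$ (i * c + x, j * c + x) * T (basis_op a i j) $$ (k, k))"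
    by (rule sum_swap_pairs)
  also have "\<dots> = (\<Sum>i<a. \<Sum>j<a. \<Sum>x<c. \<Sum>k<b. X $$ (i * c + x, j * c + x) * T (basis_op a i j) $$ (k, k))"
    by (intro sum.cong refl sum.swap)
  also have "\<dots> = (\<Sum>i<a. \<Sum>j<a. if i = j then \<Sum>x<c. X $$ (i * c + x, j * c + x) else 0)"
    by (intro sum.cong refl) (auto simp: sum_distrib_left[symmetric] tr)
  also have "\<dots> = mtrace X" using X by (simp add: mtrace_sum sum_lessThan_mult)
  finally show ?thesis .
qed

lemma psd_cptp:
  assumes T: "cptp a b T" and X: "psd a X"
  shows "psd b (T X)"
proof -
  have "linear_map a b T" "X \<in> carrier_mat a a" using T X by (auto simp: cptp_def psd_def)
  hence "tensor_id a b T 1 X = T X" by (rule tensor_id_one)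
  moreover have "psd (b * 1) (tensor_id a b T 1 X)" using T X unfolding cptp_def by (metis mult_1_right)
  ultimately show ?thesis by simp
qed

section \<open>Incoherent operations\<close>

lemma foldr_add_index:
  fixes F :: "'b \<Rightarrow> complex mat"
  assumes "\<And>x. x \<in> set xs \<Longrightarrow> F x \<in> carrier_mat m n"
  shows "foldr (+) (map F xs) (0\<^sub>m m n) \<in> carrier_mat m n"
    and "i < m \<Longrightarrow> j < n \<Longrightarrow> foldr (+) (map F xs) (0\<^sub>m m n) $$ (i, j) = (\<Sum>x\<leftarrow>xs. F x $$ (i, j))"
proof -
  have "foldr (+) (map F xs) (0\<^sub>m m n) \<in> carrier_mat m n \<and>
    (i < m \<longrightarrow> j < n \<longrightarrow> foldr (+) (map F xs) (0\<^sub>m m n) $$ (i, j) = (\<Sum>x\<leftarrow>xs. F x $$ (i, j)))"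
    using assms by (induction xs) auto
  thus "foldr (+) (map F xs) (0\<^sub>m m n) \<in> carrier_mat m n"
    and "i < m \<Longrightarrow> j < n \<Longrightarrow> foldr (+) (map F xs) (0\<^sub>m m n) $$ (i, j) = (\<Sum>x\<leftarrow>xs. F x $$ (i, j))"
    by blast+
qed

lemma diagonal_matI:
  assumes "X \<in> carrier_mat m n"
    and "\<And>i j. i < m \<Longrightarrow> j < n \<Longrightarrow> i \<noteq> j \<Longrightarrow> X $$ (i, j) = 0"
  shows "diagonal_mat X"
  using assms by (auto simp: diagonal_mat_def)

lemma psd_basis_op:
  assumes "i < n"
  shows "psd n (basis_op n i i)"
  unfolding psd_iff
proof (intro conjI allI)
  fix f :: "nat \<Rightarrow> complex"
  have "(\<Sum>k<n. \<Sum>l<n. basis_op n i i $$ (k, l) * f l * cnj (f k))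
      = (\<Sum>k<n. \<Sum>l<n. if l = i then (if k = i then f l * cnj (f k) else 0) else 0)"
    by (intro sum.cong refl) (auto simp: basis_op_index)
  also have "\<dots> = f i * cnj (f i)" using assms by simp
  finally show "0 \<le> (\<Sum>k<n. \<Sum>l<n. basis_op n i i $$ (k, l) * f l * cnj (f k))"
    using conjugate_square_positive[of "f i"] by simp
qed simp

lemma incoherent_state_basis_op:
  assumes "i < n"
  shows "incoherent_state n (basis_op n i i)"
  unfolding incoherent_state_def density_def
proof (intro conjI psd_basis_op assms)
  show "mtrace (basis_op n i i) = 1"
    using assms by (auto simp: mtrace_sum[OF basis_op_carrier] basis_op_index)
  show "diagonal_mat (basis_op n i i)"
    by (auto simp: diagonal_mat_def basis_op_def)
qed

lemma sandwich_basis_op_index: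
  assumes K: "K \<in> carrier_mat b a" and "i < a" "k < b" "l < b"
  shows "(K * basis_op a i i * mat_adjoint K) $$ (k, l) = K $$ (k, i) * cnj (K $$ (l, i))"
proof -
  have "(K * basis_op a i i) $$ (k, m) = (if m = i then K $$ (k, i) else 0)" if "m < a" for m
  proof -
    have "(K * basis_op a i i) $$ (k, m) = (\<Sum>p<a. K $$ (k, p) * basis_op a i i $$ (p, m))"
      using assms that by (intro mat_mult_index[OF K basis_op_carrier])
    also have "\<dots> = (\<Sum>p<a. if p = i then (if m = i then K $$ (k, p) else 0) else 0)"
      using that by (intro sum.cong refl) (simp add: basis_op_index)
    finally show ?thesis using assms by simp
  qed
  note KE = this
  have "(K * basis_op a i i * mat_adjoint K) $$ (k, l)
      = (\<Sum>m<a. (K * basis_op a i i) $$ (k, m) * mat_adjoint K $$ (m, l))"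
    using assms by (intro mat_mult_index[OF mult_carrier_mat[OF K basis_op_carrier] mat_adjoint_carrier[OF K]])
  also have "\<dots> = (\<Sum>m<a. if m = i then K $$ (k, i) * cnj (K $$ (l, m)) else 0)"
    using assms by (intro sum.cong refl) (simp add: KE del: index_mult_mat)
  finally show ?thesis using assms by simp
qed

text \<open>On the basis state \<open>i\<close> the operator produces column \<open>i\<close> times
  its own adjoint, and such a rank-one matrix is diagonal only if the column has at most one nonzero
  entry.\<close>

lemma incoherent_operator_column:
  assumes K: "incoherent_operator a b K" and "i < a" "k < b" "l < b" "k \<noteq> l"
  shows "K $$ (k, i) = 0 \<or> K $$ (l, i) = 0"
proof -
  have Kc: "K \<in> carrier_mat b a" using K by (simp add: incoherent_operator_def)
  have "diagonal_mat (K * basis_op a i i * mat_adjoint K)"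
    using K incoherent_state_basis_op[OF \<open>i < a\<close>] by (simp add: incoherent_operator_def)
  hence "(K * basis_op a i i * mat_adjoint K) $$ (k, l) = 0"
    using assms Kc by (simp add: diagonal_mat_def)
  thus ?thesis using sandwich_basis_op_index[OF Kc assms(2-4)] by simp
qed

lemma incoherent_state_incoherent_operation:
  assumes I: "incoherent_operation a b I" and \<rho>: "incoherent_state a \<rho>"
  shows "incoherent_state b (I \<rho>)"
proof -
  have \<rho>c: "\<rho> \<in> carrier_mat a a" using \<rho> by (simp add: incoherent_state_def density_def psd_def)
  have cp: "cptp a b I" using I by (simp add: incoherent_operation_def)
  obtain Ks where Ks: "kraus_rep a b Ks I" and inc: "\<And>K. K \<in> set Ks \<Longrightarrow> incoherent_operator a b K"
    using I by (auto simp: incoherent_operation_def)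
  have Kc: "\<And>K. K \<in> set Ks \<Longrightarrow> K \<in> carrier_mat b a" using Ks by (simp add: kraus_rep_def)
  have car: "K * \<rho> * mat_adjoint K \<in> carrier_mat b b" if "K \<in> set Ks" for K
    using Kc[OF that] \<rho>c by (meson mult_carrier_mat mat_adjoint_carrier)
  have I\<rho>: "I \<rho> = foldr (+) (map (\<lambda>K. K * \<rho> * mat_adjoint K) Ks) (0\<^sub>m b b)"
    using Ks \<rho>c by (simp add: kraus_rep_def)
  have "(\<Sum>K\<leftarrow>Ks. (K * \<rho> * mat_adjoint K) $$ (k, l)) = 0" if "k < b" "l < b" "k \<noteq> l" for k l
  proof -
    have "(K * \<rho> * mat_adjoint K) $$ (k, l) = 0" if "K \<in> set Ks" for K
      using inc[OF that] \<rho> car[OF that] \<open>k < b\<close> \<open>l < b\<close> \<open>k \<noteq> l\<close>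
      by (auto simp: incoherent_operator_def diagonal_mat_def)
    thus ?thesis by (simp cong: map_cong)
  qed
  hence "diagonal_mat (I \<rho>)"
    unfolding I\<rho> using foldr_add_index[of Ks "\<lambda>K. K * \<rho> * mat_adjoint K", OF car]
    by (intro diagonal_matI[of _ b b]) auto
  moreover have "mtrace (I \<rho>) = 1"
    using cp \<rho> \<rho>c by (simp add: cptp_def incoherent_state_def density_def)
  ultimately show ?thesis
    using psd_cptp[OF cp, of \<rho>] \<rho> by (simp add: incoherent_state_def density_def)
qed

text \<open>An incoherent \<open>\<rho>\<close> may correlate input and ancilla, but only
  classically: it is a combination of products of basis projectors, and \<open>diag\<close> controls
  \<open>T\<close> on these.\<close>

lemma incoherent_state_tensor_id:
  assumes T: "cptp a b T" and diag: "\<And>i. i < a \<Longrightarrow> diagonal_mat (T (basis_op a i i))"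
    and \<rho>: "incoherent_state (a * c) \<rho>"
  shows "incoherent_state (b * c) (tensor_id a b T c \<rho>)"
proof -
  have lin: "linear_map a b T" using T by (simp add: cptp_def)
  have \<rho>c: "\<rho> \<in> carrier_mat (a * c) (a * c)" and tr: "mtrace \<rho> = 1" and ps: "psd (a * c) \<rho>" and dg: "diagonal_mat \<rho>"
    using \<rho> by (auto simp: incoherent_state_def density_def psd_def)
  have "tensor_id a b T c \<rho> $$ (k, l) = 0" if kl: "k < b * c" "l < b * c" "k \<noteq> l" for k l
  proof -
    have kl': "k div c < b" "k mod c < c" "l div c < b" "l mod c < c"
      using kl by (auto simp: less_mult_imp_div_less intro!: mod_less_divisor gr0I)
    have "\<rho> $$ (i * c + k mod c, j * c + l mod c) * T (basis_op a i j) $$ (k div c, l div c) = 0"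
      if ij: "i < a" "j < a" for i j
    proof (cases "i * c + k mod c = j * c + l mod c")
      \<comment> \<open>A diagonal entry of \<open>\<rho>\<close> has \<open>i = j\<close> and equal
        ancilla indices. Since \<open>k\<close> and \<open>l\<close> differ, they then differ in the
        output of \<open>T\<close>, which is diagonal.\<close>
      case True
      have "i = (i * c + k mod c) div c" "k mod c = (i * c + k mod c) mod c"
        "j = (j * c + l mod c) div c" "l mod c = (j * c + l mod c) mod c" using kl' by auto
      hence "i = j" "k mod c = l mod c" using True by metis+
      moreover from this have "k div c \<noteq> l div c" using kl(3) by (metis div_mult_mod_eq)
      moreover have "T (basis_op a i i) \<in> carrier_mat b b" by (rule linear_mapD(1)[OF lin basis_op_carrier])
      ultimately have "T (basis_op a i j) $$ (k div c, l div c) = 0"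
        using diag[OF ij(1)] kl' by (auto simp: diagonal_mat_def)
      thus ?thesis by simp
    next
      case False
      thus ?thesis using dg \<rho>c ij kl' by (auto simp: diagonal_mat_def mult_add_less)
    qed
    hence "(\<Sum>i<a. \<Sum>j<a. \<rho> $$ (i * c + k mod c, j * c + l mod c) * T (basis_op a i j) $$ (k div c, l div c)) = 0"
      by (intro sum.neutral ballI) auto
    thus ?thesis using tensor_id_index[OF lin kl'(1,3,2,4), of \<rho>] by simp
  qed
  hence "diagonal_mat (tensor_id a b T c \<rho>)"
    by (rule diagonal_matI[OF tensor_map_carrier])
  moreover have "psd (b * c) (tensor_id a b T c \<rho>)" using T ps by (simp add: cptp_def)
  moreover have "mtrace (tensor_id a b T c \<rho>) = 1" using mtrace_tensor_id[OF T \<rho>c] tr by simp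
  ultimately show ?thesis by (simp add: incoherent_state_def density_def)
qed

text \<open>The reduced state is diagonal and every amplitude of the test vector has square
  \<open>1 / d\<close>, so only the total trace enters.\<close>

lemma fidelity_incoherent_state:
  assumes \<rho>: "incoherent_state (a * d) \<rho>" and d: "d > 0"
  shows "(ptrace_fst a d \<rho> *\<^sub>v max_coh_vec d) \<bullet>c max_coh_vec d = of_real (1 / real d)"
proof -
  have \<rho>c: "\<rho> \<in> carrier_mat (a * d) (a * d)" and tr: "mtrace \<rho> = 1" and dg: "diagonal_mat \<rho>"
    using \<rho> by (auto simp: incoherent_state_def density_def psd_def)
  define s where "s = complex_of_real (1 / sqrt (real d))"
  have ss: "s * cnj s = of_real (1 / real d)" using d by (simp add: s_def flip: of_real_mult)
  have mc: "max_coh_vec d \<in> carrier_vec d" and mi: "\<And>i. i < d \<Longrightarrow> max_coh_vec d $ i = s"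
    by (auto simp: max_coh_vec_def s_def)
  have pc: "ptrace_fst a d \<rho> \<in> carrier_mat d d" by (simp add: ptrace_fst_def)
  have pt: "ptrace_fst a d \<rho> $$ (i, j) = (if j = i then \<Sum>k<a. \<rho> $$ (k * d + i, k * d + i) else 0)"
    if "i < d" "j < d" for i j
    using that dg \<rho>c by (auto simp: ptrace_fst_def diagonal_mat_def mult_add_less intro!: sum.neutral)
  have "(ptrace_fst a d \<rho> *\<^sub>v max_coh_vec d) \<bullet>c max_coh_vec d
      = (\<Sum>i<d. (\<Sum>j<d. (if j = i then \<Sum>k<a. \<rho> $$ (k * d + i, k * d + i) else 0) * s) * cnj s)"
    by (simp add: cscalar_prod_sum[OF mc] mat_mult_vec_index[OF pc mc] mi pt del: index_mult_mat_vec)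
  also have "\<dots> = (\<Sum>i<d. (\<Sum>j<d. (if j = i then (\<Sum>k<a. \<rho> $$ (k * d + i, k * d + i)) * s else 0)) * cnj s)"
    by (intro sum.cong refl arg_cong2[of _ _ _ _ "(*)"]) auto
  also have "\<dots> = (\<Sum>i<d. (\<Sum>k<a. \<rho> $$ (k * d + i, k * d + i))) * (s * cnj s)"
    by (simp add: sum_distrib_right mult.assoc)
  also have "(\<Sum>i<d. (\<Sum>k<a. \<rho> $$ (k * d + i, k * d + i))) = mtrace \<rho>"
    by (subst sum.swap) (simp add: mtrace_sum[OF \<rho>c] sum_lessThan_mult)
  finally show ?thesis using tr ss by simp
qed

lemma sandwich_index:
  assumes K: "K \<in> carrier_mat b a" and X: "X \<in> carrier_mat a a" and kl: "k < b" "l < b"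
  shows "(K * X * mat_adjoint K) $$ (k, l)
    = (\<Sum>m<a. (\<Sum>p<a. K $$ (k, p) * X $$ (p, m)) * cnj (K $$ (l, m)))"
proof -
  have "(K * X * mat_adjoint K) $$ (k, l) = (\<Sum>m<a. (K * X) $$ (k, m) * mat_adjoint K $$ (m, l))"
    using kl by (intro mat_mult_index[OF mult_carrier_mat[OF K X] mat_adjoint_carrier[OF K]])
  also have "\<dots> = (\<Sum>m<a. (\<Sum>p<a. K $$ (k, p) * X $$ (p, m)) * cnj (K $$ (l, m)))"
    using kl K by (intro sum.cong refl) (simp add: mat_mult_index[OF K X] del: index_mult_mat)
  finally show ?thesis .
qed

lemma ket_bra_carrier [simp]: "w \<in> carrier_vec a \<Longrightarrow> ket_bra w \<in> carrier_mat a a"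
  by (auto simp: ket_bra_def)

text \<open>A single Kraus operator keeps a pure state pure: the result is the unnormalized
  projector of the image of \<open>w\<close>.\<close>

lemma sandwich_ket_bra_index:
  assumes K: "K \<in> carrier_mat b a" and w: "w \<in> carrier_vec a" and kl: "k < b" "l < b"
  shows "(K * ket_bra w * mat_adjoint K) $$ (k, l)
    = (\<Sum>p<a. K $$ (k, p) * w $ p) * cnj (\<Sum>p<a. K $$ (l, p) * w $ p)"
proof -
  have "(K * ket_bra w * mat_adjoint K) $$ (k, l)
      = (\<Sum>m<a. (\<Sum>p<a. K $$ (k, p) * w $ p) * cnj (K $$ (l, m) * w $ m))"
    using w by (subst sandwich_index[OF K _ kl])
      (auto simp: ket_bra_def sum_distrib_right sum_distrib_left mult_ac intro!: sum.cong)
  thus ?thesis by (simp add: sum_distrib_left)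
qed

text \<open>The columns of an incoherent operator on a space of dimension \<open>N\<close> have at most one nonzero
  entry each, so that every vector in its image has at most \<open>N\<close> nonzero entries.\<close>

lemma sum_norm_squared_image_incoherent_operator_le:
  fixes x :: "nat \<Rightarrow> complex"
  assumes K: "incoherent_operator N b K"
  defines "v \<equiv> \<lambda>i. \<Sum>p<N. K $$ (i, p) * x p"
  shows "(\<Sum>i<b. cmod (v i))\<^sup>2 \<le> real N * (\<Sum>i<b. (cmod (v i))\<^sup>2)"
proof -
  define S where "S = {i. i < b \<and> (\<exists>p<N. K $$ (i, p) \<noteq> 0)}"
  \<comment> \<open>The row of the nonzero entry of column \<open>p\<close>. For a zero column the
    value is arbitrary, which is harmless since \<open>S\<close> only has to be contained in the
    image.\<close>
  define f where "f p = (SOME i. i < b \<and> K $$ (i, p) \<noteq> 0)" for p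
  have "S \<subseteq> f ` {..<N}"
  proof
    fix i assume "i \<in> S"
    then obtain p where p: "i < b" "p < N" "K $$ (i, p) \<noteq> 0" by (auto simp: S_def)
    hence "f p < b \<and> K $$ (f p, p) \<noteq> 0"
      using someI[of "\<lambda>i. i < b \<and> K $$ (i, p) \<noteq> 0" i] by (simp add: f_def)
    hence "f p = i" using incoherent_operator_column[OF K p(2), of "f p" i] p by auto
    thus "i \<in> f ` {..<N}" using p by auto
  qed
  hence cS: "card S \<le> N"
    by (metis card_image_le card_lessThan card_mono finite_imageI finite_lessThan order_trans)
  have SB: "S \<subseteq> {..<b}" by (auto simp: S_def)
  have "v i = 0" if "i < b" "i \<notin> S" for i
    using that unfolding v_def S_def by (intro sum.neutral) auto
  \<comment> \<open>The factor 1 is inserted for Cauchy-Schwarz on \<open>S\<close>, where it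
    contributes \<open>sqrt (card S)\<close>.\<close>
  hence "(\<Sum>i<b. cmod (v i)) = (\<Sum>i\<in>S. \<bar>1\<bar> * \<bar>cmod (v i)\<bar>)"
    using SB by (intro sum.mono_neutral_cong_right) auto
  also have "\<dots> \<le> L2_set (\<lambda>_. 1) S * L2_set (\<lambda>i. cmod (v i)) S" by (rule L2_set_mult_ineq)
  finally have "(\<Sum>i<b. cmod (v i))\<^sup>2 \<le> (L2_set (\<lambda>_. 1) S * L2_set (\<lambda>i. cmod (v i)) S)\<^sup>2"
    by (intro power_mono sum_nonneg) auto
  also have "\<dots> = real (card S) * (\<Sum>i\<in>S. (cmod (v i))\<^sup>2)"
    by (simp add: L2_set_def power_mult_distrib sum_nonneg)
  also have "\<dots> \<le> real N * (\<Sum>i<b. (cmod (v i))\<^sup>2)"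
    using cS SB by (intro mult_mono sum_mono2 sum_nonneg) auto
  finally show ?thesis .
qed

text \<open>Sparsity is applied to each Kraus branch separately. By trace preservation the squared
  norms of the branches add up to that of \<open>w\<close>, so the number of branches does not enter
  the bound.\<close>

lemma norm_mtrace_incoherent_operation_le:
  assumes I: "incoherent_operation N b I" and w: "w \<in> carrier_vec N"
    and W: "W \<in> carrier_mat b b" and u0: "0 \<le> u"
    and u: "\<And>i j. i < b \<Longrightarrow> j < b \<Longrightarrow> cmod (W $$ (i, j)) \<le> u"
  shows "cmod (mtrace (W * I (ket_bra w))) \<le> u * real N * (\<Sum>i<N. (cmod (w $ i))\<^sup>2)"
proof -
  obtain Ks where Ks: "kraus_rep N b Ks I" and inc: "\<And>K. K \<in> set Ks \<Longrightarrow> incoherent_operator N b K"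
    using I by (auto simp: incoherent_operation_def)
  have cp: "cptp N b I" using I by (simp add: incoherent_operation_def)
  have Kc: "\<And>K. K \<in> set Ks \<Longrightarrow> K \<in> carrier_mat b N" using Ks by (simp add: kraus_rep_def)
  define v where "v K i = (\<Sum>p<N. K $$ (i, p) * w $ p)" for K :: "complex mat" and i
  define X where "X = ket_bra w"
  have X: "X \<in> carrier_mat N N" using w by (simp add: X_def)
  have car: "K * X * mat_adjoint K \<in> carrier_mat b b" if "K \<in> set Ks" for K
    using Kc[OF that] X by (meson mult_carrier_mat mat_adjoint_carrier)
  have IX: "I X = foldr (+) (map (\<lambda>K. K * X * mat_adjoint K) Ks) (0\<^sub>m b b)"
    using Ks X by (simp add: kraus_rep_def)
  have IXc: "I X \<in> carrier_mat b b" unfolding IX by (intro foldr_add_index(1) car)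
  have idx: "I X $$ (k, l) = (\<Sum>K\<leftarrow>Ks. v K k * cnj (v K l))" if "k < b" "l < b" for k l
  proof -
    have "I X $$ (k, l) = (\<Sum>K\<leftarrow>Ks. (K * X * mat_adjoint K) $$ (k, l))"
      unfolding IX using that by (intro foldr_add_index(2) car)
    also have "\<dots> = (\<Sum>K\<leftarrow>Ks. v K k * cnj (v K l))"
      unfolding X_def v_def using sandwich_ket_bra_index[OF Kc w that]
      by (intro arg_cong[of _ _ sum_list] map_cong refl)
    finally show ?thesis .
  qed
  define r where "r = length Ks"
  define V where "V q = v (Ks ! q)" for q
  have idx': "I X $$ (k, l) = (\<Sum>q<r. V q k * cnj (V q l))" if "k < b" "l < b" for k l
    unfolding idx[OF that] by (simp add: sum_list_sum_nth r_def V_def atLeast0LessThan)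
  have "complex_of_real (\<Sum>q<r. \<Sum>i<b. (cmod (V q i))\<^sup>2) = (\<Sum>q<r. \<Sum>i<b. V q i * cnj (V q i))"
    by (simp add: complex_norm_square del: of_real_power)
  also have "\<dots> = mtrace (I X)"
    by (subst sum.swap) (simp add: mtrace_sum[OF IXc] idx')
  also have "\<dots> = mtrace X" using cp X by (simp add: cptp_def)
  also have "\<dots> = complex_of_real (\<Sum>i<N. (cmod (w $ i))\<^sup>2)"
    using w by (simp add: mtrace_sum[OF X] complex_norm_square del: of_real_power) (simp add: X_def ket_bra_def)
  finally have norm: "(\<Sum>q<r. \<Sum>i<b. (cmod (V q i))\<^sup>2) = (\<Sum>i<N. (cmod (w $ i))\<^sup>2)"
    by (simp only: of_real_eq_iff)
  have "mtrace (W * I X) = (\<Sum>i<b. \<Sum>j<b. W $$ (i, j) * I X $$ (j, i))"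
    using W IXc by (subst mtrace_sum[of _ b])
      (auto simp: mat_mult_index[OF W IXc] simp del: index_mult_mat(1))
  also have "\<dots> = (\<Sum>i<b. \<Sum>j<b. \<Sum>q<r. W $$ (i, j) * (V q j * cnj (V q i)))"
    by (simp add: idx' sum_distrib_left)
  finally have "cmod (mtrace (W * I X)) \<le> (\<Sum>i<b. \<Sum>j<b. \<Sum>q<r. cmod (W $$ (i, j)) * (cmod (V q j) * cmod (V q i)))"
    by (simp add: norm_mult sum_norm_le)
  \<comment> \<open>With all entries replaced by \<open>u\<close>, each branch contributes
    \<open>u\<close> times its squared 1-norm; sparsity then trades the squared 1-norm for the
    squared 2-norm at the price of a factor \<open>N\<close>.\<close>
  also have "\<dots> \<le> (\<Sum>i<b. \<Sum>j<b. \<Sum>q<r. u * (cmod (V q j) * cmod (V q i)))"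
    using u by (intro sum_mono mult_right_mono) auto
  also have "\<dots> = (\<Sum>i<b. \<Sum>q<r. \<Sum>j<b. u * (cmod (V q j) * cmod (V q i)))"
    by (intro sum.cong refl sum.swap)
  also have "\<dots> = (\<Sum>q<r. \<Sum>i<b. \<Sum>j<b. u * (cmod (V q j) * cmod (V q i)))" by (rule sum.swap)
  also have "\<dots> = (\<Sum>q<r. u * (\<Sum>i<b. cmod (V q i))\<^sup>2)"
    by (simp add: power2_eq_square sum_product sum_distrib_left mult_ac)
  also have "\<dots> \<le> (\<Sum>q<r. u * (real N * (\<Sum>i<b. (cmod (V q i))\<^sup>2)))"
  proof (intro sum_mono mult_left_mono u0)
    fix q assume "q \<in> {..<r}"
    hence "incoherent_operator N b (Ks ! q)" by (intro inc) (simp add: r_def)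
    thus "(\<Sum>i<b. cmod (V q i))\<^sup>2 \<le> real N * (\<Sum>i<b. (cmod (V q i))\<^sup>2)"
      unfolding V_def v_def by (rule sum_norm_squared_image_incoherent_operator_le)
  qed
  also have "\<dots> = u * real N * (\<Sum>q<r. \<Sum>i<b. (cmod (V q i))\<^sup>2)"
    by (simp add: sum_distrib_left mult.assoc)
  finally show ?thesis unfolding norm X_def .
qed

section \<open>An incoherent reset operation\<close>

text \<open>Discards the input and prepares the basis state 0. It serves as every step of the
  trivial generation protocol.\<close>

definition reset_map :: "nat \<Rightarrow> op_map" where
  "reset_map b X = mtrace X \<cdot>\<^sub>m basis_op b 0 0"

text \<open>The \<open>r\<close>-th Kraus operator sends basis state \<open>r\<close> to basis state
  0 and annihilates the others. The same \<open>G\<close> factors the Choi matrix and gives the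
  Kraus list \<open>E\<close>.\<close>

lemma incoherent_operation_reset_map:
  assumes b: "0 < b"
  shows "incoherent_operation a b (reset_map b)"
  unfolding incoherent_operation_def
proof (intro conjI exI)
  define M :: "nat \<Rightarrow> nat \<Rightarrow> nat \<Rightarrow> nat \<Rightarrow> complex"
    where "M i j k l = (if i = j then if k = 0 \<and> l = 0 then 1 else 0 else 0)" for i j k l
  define G :: "nat \<Rightarrow> nat \<Rightarrow> nat \<Rightarrow> complex"
    where "G r k i = (if r = i then if k = 0 then 1 else 0 else 0)" for r k i
  show "cptp a b (reset_map b)"
  proof (rule cptp_choiI[where M = M and G = G and R = a])
    fix X :: "complex mat" assume X: "X \<in> carrier_mat a a"
    have "(\<Sum>j<a. X $$ (i, j) * M i j k l) = (if k = 0 \<and> l = 0 then X $$ (i, i) else 0)" if "i < a" for i k l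
      using that by (simp add: M_def if_distrib[of "(*) _"] cong: if_cong)
    thus "reset_map b X = mat b b (\<lambda>(k, l). \<Sum>i<a. \<Sum>j<a. X $$ (i, j) * M i j k l)"
      using X by (intro eq_matI) (auto simp: reset_map_def basis_op_def mtrace_sum)
  next
    fix i j k l assume "i < a"
    have "(\<Sum>r<a. G r k i * cnj (G r l j)) = (\<Sum>r<a. if r = i then M i j k l else 0)"
      by (intro sum.cong refl) (auto simp: G_def M_def)
    thus "M i j k l = (\<Sum>r<a. G r k i * cnj (G r l j))" using \<open>i < a\<close> by simp
  next
    fix i j
    have "(\<Sum>k<b. M i j k k) = (\<Sum>k<b. if k = 0 then if i = j then 1 else 0 else 0)"
      by (intro sum.cong refl) (auto simp: M_def)
    thus "(\<Sum>k<b. M i j k k) = (if i = j then 1 else 0)" using b by simp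
  qed
  define E :: "nat \<Rightarrow> complex mat" where "E r = mat b a (\<lambda>(k, i). G r k i)" for r
  have Ec: "E r \<in> carrier_mat b a" for r by (simp add: E_def)
  have sw: "(E r * X * mat_adjoint (E r)) $$ (k, l) = (if k = 0 \<and> l = 0 then X $$ (r, r) else 0)"
    if "X \<in> carrier_mat a a" "k < b" "l < b" "r < a" for X k l r
  proof -
    have inner: "(\<Sum>p<a. G r k p * X $$ (p, m)) = (if k = 0 then X $$ (r, m) else 0)" for m
      using that by (simp add: G_def if_distrib[of "\<lambda>x. x * _"] cong: if_cong)
    have "(E r * X * mat_adjoint (E r)) $$ (k, l)
        = (\<Sum>m<a. (\<Sum>p<a. G r k p * X $$ (p, m)) * cnj (G r l m))"
      using that by (subst sandwich_index[OF Ec that(1-3)]) (simp add: E_def)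
    also have "\<dots> = (\<Sum>m<a. if m = r then (if k = 0 \<and> l = 0 then X $$ (r, m) else 0) else 0)"
      unfolding inner by (intro sum.cong refl) (auto simp: G_def)
    finally show ?thesis using that by simp
  qed
  have car: "E r * X * mat_adjoint (E r) \<in> carrier_mat b b" if "X \<in> carrier_mat a a" for X r
    using Ec[of r] that by (meson mult_carrier_mat mat_adjoint_carrier)
  have EE: "(mat_adjoint (E r) * E r) $$ (i, j) = (if i = r then if j = r then 1 else 0 else 0)"
    if "i < a" "j < a" for i j r
  proof -
    have "(mat_adjoint (E r) * E r) $$ (i, j) = (\<Sum>k<b. mat_adjoint (E r) $$ (i, k) * E r $$ (k, j))"
      by (rule mat_mult_index[OF mat_adjoint_carrier[OF Ec] Ec that])
    also have "\<dots> = (\<Sum>k<b. if k = 0 then if i = r then if j = r then 1 else 0 else 0 else 0)"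
      using that Ec[of r] by (intro sum.cong refl) (auto simp: E_def G_def)
    finally show ?thesis using b by simp
  qed
  have EEc: "mat_adjoint (E r) * E r \<in> carrier_mat a a" for r
    using Ec[of r] by (meson mult_carrier_mat mat_adjoint_carrier)
  let ?Ks = "map E [0..<a]"
  show "kraus_rep a b ?Ks (reset_map b)"
    unfolding kraus_rep_def
  proof (intro conjI ballI)
    show "foldr (+) (map (\<lambda>K. mat_adjoint K * K) ?Ks) (0\<^sub>m a a) = 1\<^sub>m a"
    proof (rule eq_matI)
      fix i j assume "i < dim_row (1\<^sub>m a :: complex mat)" "j < dim_col (1\<^sub>m a :: complex mat)"
      hence ij: "i < a" "j < a" by auto
      have "foldr (+) (map (\<lambda>K. mat_adjoint K * K) ?Ks) (0\<^sub>m a a) $$ (i, j)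
          = (\<Sum>K\<leftarrow>?Ks. (mat_adjoint K * K) $$ (i, j))"
        using ij EEc by (intro foldr_add_index(2)) auto
      also have "\<dots> = (\<Sum>r<a. (mat_adjoint (E r) * E r) $$ (i, j))"
        by (simp add: sum_list_distinct_conv_sum_set atLeast0LessThan o_def del: index_mult_mat)
      also have "\<dots> = (1\<^sub>m a :: complex mat) $$ (i, j)" using ij by (simp add: EE del: index_mult_mat)
      finally show "foldr (+) (map (\<lambda>K. mat_adjoint K * K) ?Ks) (0\<^sub>m a a) $$ (i, j) = 1\<^sub>m a $$ (i, j)" .
    qed (use foldr_add_index(1)[of ?Ks "\<lambda>K. mat_adjoint K * K" a a] EEc in auto)
  next
    fix X :: "complex mat" assume X: "X \<in> carrier_mat a a"
    show "reset_map b X = foldr (+) (map (\<lambda>K. K * X * mat_adjoint K) ?Ks) (0\<^sub>m b b)" (is "_ = ?F")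
    proof -
      have Fc: "?F \<in> carrier_mat b b" using car[OF X] by (intro foldr_add_index(1)) auto
      show ?thesis
      proof (rule eq_matI)
      fix k l assume "k < dim_row ?F" "l < dim_col ?F"
      hence kl: "k < b" "l < b" using Fc by auto
      have "?F $$ (k, l) = (\<Sum>K\<leftarrow>?Ks. (K * X * mat_adjoint K) $$ (k, l))"
        using kl car[OF X] by (intro foldr_add_index(2)) auto
      also have "\<dots> = (\<Sum>r<a. (E r * X * mat_adjoint (E r)) $$ (k, l))"
        by (simp add: sum_list_distinct_conv_sum_set atLeast0LessThan o_def del: index_mult_mat)
      also have "\<dots> = (if k = 0 \<and> l = 0 then mtrace X else 0)"
        using kl X by (simp add: sw mtrace_sum del: index_mult_mat)
      finally show "reset_map b X $$ (k, l) = ?F $$ (k, l)"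
        using kl by (simp add: reset_map_def basis_op_def)
      qed (use Fc in \<open>auto simp: reset_map_def basis_op_def\<close>)
    qed
  qed (use Ec in auto)
  show "\<forall>K\<in>set ?Ks. incoherent_operator a b K"
  proof
    fix K assume "K \<in> set ?Ks"
    then obtain r where r: "r < a" "K = E r" by auto
    show "incoherent_operator a b K"
      unfolding incoherent_operator_def r
    proof (intro conjI Ec allI impI)
      fix \<delta> assume "incoherent_state a \<delta>"
      hence "\<delta> \<in> carrier_mat a a" by (simp add: incoherent_state_def density_def psd_def)
      thus "diagonal_mat (E r * \<delta> * mat_adjoint (E r))"
        using r by (intro diagonal_matI[OF car]) (auto simp: sw simp del: index_mult_mat)
    qed
  qed
qed

section \<open>The channel\<close>

text \<open>Written through its Choi matrix, as \<open>cptp_choiI\<close> expects. On bits, the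
  relation \<open>i \<noteq> j\<close> is the matrix of the bit flip, so \<open>U\<close> is
  weighted by the flip expectation of \<open>X\<close>.\<close>

definition flip_map :: "nat \<Rightarrow> (nat \<Rightarrow> nat \<Rightarrow> real) \<Rightarrow> op_map" where
  "flip_map b U X = mat b b (\<lambda>(k, l). \<Sum>i<2. \<Sum>j<2. X $$ (i, j) *
     of_real ((if i = j then if k = l then 1 else 0 else U k l) / real b))"

text \<open>The Choi matrix of \<open>flip_map\<close> is \<open>J = (1 \<otimes> 1 + \<sigma>\<^sub>x \<otimes> U) / b\<close>. Since \<open>(\<sigma>\<^sub>x \<otimes> U)\<^sup>2 = 1\<close>, it
  satisfies \<open>J\<^sup>2 = 2 J / b\<close>, hence \<open>J = (b / 2) J J\<^sup>\<dagger>\<close>.\<close>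

lemma cptp_flip_map:
  assumes b: "0 < b"
    and sym: "\<And>k l. k < b \<Longrightarrow> l < b \<Longrightarrow> U k l = U l k"
    and sq: "\<And>k l. k < b \<Longrightarrow> l < b \<Longrightarrow> (\<Sum>t<b. U k t * U t l) = (if k = l then 1 else 0)"
    and tr: "(\<Sum>k<b. U k k) = 0"
  shows "cptp 2 b (flip_map b U)"
proof -
  define M where "M i j k l = complex_of_real ((if i = j then if k = l then 1 else 0 else U k l) / real b)"
    for i j k l :: nat
  define e where "e k t = (if k = t then 1 else 0 :: real)" for k t :: nat
  define g where "g s t k i = (if i = s then e k t else U k t)" for s t k i :: nat
  \<comment> \<open>The columns of \<open>J\<close>, indexed by \<open>r = s * b + t\<close>, serve
    as Kraus operators. The normalization is
    \<open>sqrt (b / 2) / b = 1 / sqrt (2 * b)\<close>.\<close>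
  define G where "G r k i = complex_of_real (g (r div b) (r mod b) k i / sqrt (2 * real b))" for r k i
  show ?thesis
  proof (rule cptp_choiI[where M = M and G = G and R = "2 * b"])
    fix X :: "complex mat"
    show "flip_map b U X = mat b b (\<lambda>(k, l). \<Sum>i<2. \<Sum>j<2. X $$ (i, j) * M i j k l)"
      by (simp add: flip_map_def M_def)
  next
    fix i j k l :: nat assume ij: "i < 2" "j < 2" and kl: "k < b" "l < b"
    have dd: "(\<Sum>t<b. e k t * e l t) = (if k = l then 1 else 0)"
      using kl by (simp add: e_def if_distrib[of "\<lambda>x. x * _"] cong: if_cong)
    have dU: "(\<Sum>t<b. e k t * U l t) = U k l"
      using kl sym[of l k] by (simp add: e_def if_distrib[of "\<lambda>x. x * _"] cong: if_cong)
    have Ud: "(\<Sum>t<b. U k t * e l t) = U k l"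
      using kl by (simp add: e_def if_distrib[of "(*) _"] cong: if_cong)
    have UU: "(\<Sum>t<b. U k t * U l t) = (if k = l then 1 else 0)"
      unfolding sq[OF kl, symmetric] using kl sym by (intro sum.cong) auto
    \<comment> \<open>Both values of \<open>s\<close> contribute the same amount, whence the factor
      2.\<close>
    have "(\<Sum>s<2. \<Sum>t<b. g s t k i * g s t l j) = 2 * (if i = j then if k = l then 1 else 0 else U k l)"
    proof -
      consider "i = 0" "j = 0" | "i = 0" "j = 1" | "i = 1" "j = 0" | "i = 1" "j = 1"
        using ij by linarith
      thus ?thesis by cases (simp_all add: g_def numeral_2_eq_2 dd dU Ud UU)
    qed
    hence "(\<Sum>r<2 * b. G r k i * cnj (G r l j))
        = of_real (2 * (if i = j then if k = l then 1 else 0 else U k l) / (sqrt (2 * real b) * sqrt (2 * real b)))"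
      by (simp only: sum_lessThan_mult) (simp add: G_def flip: sum_divide_distrib of_real_sum of_real_mult of_real_divide)
    also have "\<dots> = M i j k l" using b by (simp add: M_def)
    finally show "M i j k l = (\<Sum>r<2 * b. G r k i * cnj (G r l j))" ..
  next
    fix i j :: nat
    show "(\<Sum>k<b. M i j k k) = (if i = j then 1 else 0)"
      using b tr by (simp add: M_def flip: sum_divide_distrib of_real_sum)
  qed
qed

lemma diagonal_flip_map_basis_op: "diagonal_mat (flip_map b U (basis_op 2 i i))"
proof (rule diagonal_matI[of _ b b])
  fix k l assume kl: "k < b" "l < b" "k \<noteq> l"
  have "flip_map b U (basis_op 2 i i) $$ (k, l) = (\<Sum>i'<2. \<Sum>j'<2. basis_op 2 i i $$ (i', j') *
      of_real ((if i' = j' then if k = l then 1 else 0 else U k l) / real b))"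
    using kl by (simp add: flip_map_def)
  also have "\<dots> = 0"
    using kl by (intro sum.neutral ballI) (simp add: basis_op_index)
  finally show "flip_map b U (basis_op 2 i i) $$ (k, l) = 0" .
qed (simp add: flip_map_def)

section \<open>Tensor powers of the witness\<close>

text \<open>The recursion splits off the first factor as \<open>tensor_power\<close> does, so that
  the two can be multiplied factor by factor.\<close>

primrec kron_power :: "complex mat \<Rightarrow> nat \<Rightarrow> complex mat" where
  "kron_power W 0 = 1\<^sub>m 1"
| "kron_power W (Suc n) = kron W (kron_power W n)"

lemma kron_power_carrier: "W \<in> carrier_mat b b \<Longrightarrow> kron_power W n \<in> carrier_mat (b ^ n) (b ^ n)"
  by (induction n) auto

lemma kron_power_square:
  assumes "W \<in> carrier_mat b b" "W * W = 1\<^sub>m b"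
  shows "kron_power W n * kron_power W n = 1\<^sub>m (b ^ n)"
proof (induction n)
  case (Suc n)
  show ?case
    using kron_mult_kron[OF assms(1) kron_power_carrier[OF assms(1)] assms(1) kron_power_carrier[OF assms(1)]]
    by (simp add: Suc assms(2) kron_one)
qed simp

lemma tensor_index_cases:
  fixes k :: nat
  assumes "k < a * b"
  obtains i j where "k = i * b + j" "i < a" "j < b"
proof
  show "k = k div b * b + k mod b" by simp
  show "k div b < a" using assms by (simp add: less_mult_imp_div_less)
  show "k mod b < b" using assms by (intro mod_less_divisor gr0I) auto
qed

lemma kron_power_hermitian:
  assumes W: "W \<in> carrier_mat b b" and herm: "\<And>i j. i < b \<Longrightarrow> j < b \<Longrightarrow> W $$ (i, j) = cnj (W $$ (j, i))"
  shows "k < b ^ n \<Longrightarrow> l < b ^ n \<Longrightarrow> kron_power W n $$ (k, l) = cnj (kron_power W n $$ (l, k))"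
proof (induction n arbitrary: k l)
  case (Suc n)
  obtain i i' where k: "k = i * b ^ n + i'" "i < b" "i' < b ^ n"
    using Suc.prems(1) tensor_index_cases[of k b "b ^ n"] by auto
  obtain j j' where l: "l = j * b ^ n + j'" "j < b" "j' < b ^ n"
    using Suc.prems(2) tensor_index_cases[of l b "b ^ n"] by auto
  show ?case
    using k l herm[of i j] Suc.IH[of i' j']
    by (simp add: kron_index[OF W kron_power_carrier[OF W]])
qed auto

lemma norm_kron_power_le:
  assumes W: "W \<in> carrier_mat b b" and u: "\<And>i j. i < b \<Longrightarrow> j < b \<Longrightarrow> cmod (W $$ (i, j)) \<le> u" "0 \<le> u"
  shows "k < b ^ n \<Longrightarrow> l < b ^ n \<Longrightarrow> cmod (kron_power W n $$ (k, l)) \<le> u ^ n"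
proof (induction n arbitrary: k l)
  case (Suc n)
  obtain i i' where k: "k = i * b ^ n + i'" "i < b" "i' < b ^ n"
    using Suc.prems(1) tensor_index_cases[of k b "b ^ n"] by auto
  obtain j j' where l: "l = j * b ^ n + j'" "j < b" "j' < b ^ n"
    using Suc.prems(2) tensor_index_cases[of l b "b ^ n"] by auto
  show ?case
    using k l u Suc.IH[of i' j']
    by (auto simp: kron_index[OF W kron_power_carrier[OF W]] norm_mult intro!: mult_mono)
qed auto

text \<open>A Hermitian involution is its own adjoint and its own inverse, hence unitary. This
  supplies the contraction hypothesis of \<open>norm_mtrace_mult_le_trace_norm\<close>.\<close>

lemma hermitian_involution_isometry:
  assumes W: "W \<in> carrier_mat n n" and sq: "W * W = 1\<^sub>m n"
    and herm: "\<And>i j. i < n \<Longrightarrow> j < n \<Longrightarrow> W $$ (i, j) = cnj (W $$ (j, i))"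
  shows "(\<Sum>i<n. (cmod (\<Sum>j<n. cnj (W $$ (j, i)) * x j))\<^sup>2) = (\<Sum>i<n. (cmod (x i))\<^sup>2)"
proof -
  have WW: "(\<Sum>i<n. W $$ (k, i) * W $$ (i, j)) = (if k = j then 1 else 0)" if "k < n" "j < n" for k j
    using mat_mult_index[OF W W that] that by (simp add: sq)
  define y where "y i = (\<Sum>j<n. cnj (W $$ (j, i)) * x j)" for i
  have y: "y i = (\<Sum>j<n. W $$ (i, j) * x j)" if "i < n" for i
    unfolding y_def using herm[OF that] by (intro sum.cong) (simp_all only: lessThan_iff)
  have "complex_of_real (\<Sum>i<n. (cmod (y i))\<^sup>2) = (\<Sum>i<n. y i * cnj (y i))"
    by (simp add: complex_norm_square del: of_real_power)
  also have "\<dots> = (\<Sum>i<n. \<Sum>k<n. W $$ (k, i) * y i * cnj (x k))"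
  proof (intro sum.cong refl)
    fix i
    show "y i * cnj (y i) = (\<Sum>k<n. W $$ (k, i) * y i * cnj (x k))"
      by (subst (2) y_def) (simp add: sum_distrib_left mult_ac)
  qed
  also have "\<dots> = (\<Sum>k<n. \<Sum>i<n. W $$ (k, i) * y i * cnj (x k))" by (rule sum.swap)
  also have "\<dots> = (\<Sum>k<n. (\<Sum>i<n. W $$ (k, i) * y i) * cnj (x k))"
    by (simp add: sum_distrib_right)
  also have "\<dots> = (\<Sum>k<n. x k * cnj (x k))"
  proof (intro sum.cong refl)
    fix k assume "k \<in> {..<n}"
    hence k: "k < n" by simp
    have "(\<Sum>i<n. W $$ (k, i) * y i) = (\<Sum>i<n. \<Sum>j<n. W $$ (k, i) * W $$ (i, j) * x j)"
      by (simp add: y sum_distrib_left mult.assoc)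
    also have "\<dots> = (\<Sum>j<n. \<Sum>i<n. W $$ (k, i) * W $$ (i, j) * x j)" by (rule sum.swap)
    also have "\<dots> = (\<Sum>j<n. if k = j then x j else 0)"
      using k by (intro sum.cong refl) (auto simp: WW simp flip: sum_distrib_right)
    finally show "(\<Sum>i<n. W $$ (k, i) * y i) * cnj (x k) = x k * cnj (x k)" using k by simp
  qed
  also have "\<dots> = complex_of_real (\<Sum>i<n. (cmod (x i))\<^sup>2)"
    by (simp add: complex_norm_square del: of_real_power)
  finally show ?thesis by (simp only: of_real_eq_iff y_def)
qed

lemma linear_map_tensor_power:
  assumes "linear_map a b T"
  shows "linear_map (a ^ n) (b ^ n) (tensor_power a b T n)"
proof (induction n)
  case 0
  show ?case by (simp add: linear_map_def)
next
  case (Suc n)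
  show ?case by (simp add: linear_map_tensor_map)
qed

text \<open>Input, channel and witness are all products, so the expectation is a power; the value 1
  for one copy persists for every \<open>n\<close>.\<close>

lemma mtrace_kron_power_tensor_power:
  assumes T: "linear_map a b T" and W: "W \<in> carrier_mat b b"
  shows "mtrace (kron_power W n * tensor_power a b T n (max_coh_state (a ^ n)))
    = mtrace (W * T (max_coh_state a)) ^ n"
proof (induction n)
  case 0
  have "mtrace (1\<^sub>m 1 * max_coh_state 1) = 1"
    by (subst left_mult_one_mat[of _ 1 1]) (auto simp: mtrace_def max_coh_state_eq)
  thus ?case by simp
next
  case (Suc n)
  note lin = linear_map_tensor_power[OF T, of n]
  note Wn = kron_power_carrier[OF W, of n]
  have Tc: "T (max_coh_state a) \<in> carrier_mat b b" by (rule linear_mapD(1)[OF T max_coh_state_carrier])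
  have Tnc: "tensor_power a b T n (max_coh_state (a ^ n)) \<in> carrier_mat (b ^ n) (b ^ n)"
    by (rule linear_mapD(1)[OF lin max_coh_state_carrier])
  have "tensor_power a b T (Suc n) (max_coh_state (a ^ Suc n))
      = kron (T (max_coh_state a)) (tensor_power a b T n (max_coh_state (a ^ n)))"
    using tensor_map_kron[OF T lin max_coh_state_carrier max_coh_state_carrier]
    by (simp add: kron_max_coh_state)
  hence "kron_power W (Suc n) * tensor_power a b T (Suc n) (max_coh_state (a ^ Suc n))
      = kron (W * T (max_coh_state a)) (kron_power W n * tensor_power a b T n (max_coh_state (a ^ n)))"
    by (simp only: kron_power.simps kron_mult_kron[OF W Wn Tc Tnc])
  thus ?case
    using mtrace_kron[OF mult_carrier_mat[OF W Tc] mult_carrier_mat[OF Wn Tnc]] Suc by simp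
qed

section \<open>Lower bound on the simulation cost\<close>

text \<open>One input bounds the diamond distance from below: the maximally coherent state without
  ancilla. Between two outputs, the expectation of a contraction differs by at most the trace norm
  of their difference. In \<open>a * u\<close>, each copy contributes its input dimension to the
  support and one factor \<open>u\<close> to the entries.\<close>

lemma simulation_bound:
  assumes T: "linear_map a b T" and a: "0 < a" and W: "W \<in> carrier_mat b b" and sq: "W * W = 1\<^sub>m b"
    and herm: "\<And>i j. i < b \<Longrightarrow> j < b \<Longrightarrow> W $$ (i, j) = cnj (W $$ (j, i))"
    and u: "\<And>i j. i < b \<Longrightarrow> j < b \<Longrightarrow> cmod (W $$ (i, j)) \<le> u" "0 \<le> u"
    and test: "mtrace (W * T (max_coh_state a)) = 1"
    and sim: "simulation a b T n d \<epsilon> I"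
  shows "1 - \<epsilon> \<le> real d * (real a * u) ^ n"
proof -
  define S where "S = (\<lambda>\<rho>. I (kron \<rho> (max_coh_state d)))"
  have d: "0 < d" and I: "incoherent_operation (a ^ n * d) (b ^ n) I"
    and dist: "diamond_dist (a ^ n) (b ^ n) S (tensor_power a b T n) \<le> ereal \<epsilon>"
    using sim by (auto simp: simulation_def S_def)
  have linI: "linear_map (a ^ n * d) (b ^ n) I" using I by (simp add: incoherent_operation_def cptp_def)
  note linT = linear_map_tensor_power[OF T, of n]
  have kc: "kron X (max_coh_state d) \<in> carrier_mat (a ^ n * d) (a ^ n * d)"
    if "X \<in> carrier_mat (a ^ n) (a ^ n)" for X using that by simp
  \<comment> \<open>Linearity of \<open>S\<close> lets \<open>tensor_id_one\<close> evaluate its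
    extension by the trivial ancilla.\<close>
  have linS: "linear_map (a ^ n) (b ^ n) S"
    unfolding linear_map_def
  proof (intro conjI ballI allI)
    fix X :: "complex mat" assume X: "X \<in> carrier_mat (a ^ n) (a ^ n)"
    show "S X \<in> carrier_mat (b ^ n) (b ^ n)" unfolding S_def by (rule linear_mapD(1)[OF linI kc[OF X]])
    fix Y :: "complex mat" assume Y: "Y \<in> carrier_mat (a ^ n) (a ^ n)"
    have "kron (X + Y) (max_coh_state d) = kron X (max_coh_state d) + kron Y (max_coh_state d)"
    proof (rule eq_mat_tensorI)
      fix i i' j j' assume "i < a ^ n" "i' < d" "j < a ^ n" "j' < d"
      thus "kron (X + Y) (max_coh_state d) $$ (i * d + i', j * d + j')
          = (kron X (max_coh_state d) + kron Y (max_coh_state d)) $$ (i * d + i', j * d + j')"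
        using X Y mult_add_less[of i "a ^ n" i' d] mult_add_less[of j "a ^ n" j' d]
        by (simp add: kron_index[of _ "a ^ n" "a ^ n" _ d d] distrib_right
            carrier_matD[OF kc[OF X]] carrier_matD[OF kc[OF Y]])
    qed (use X Y kc in auto)
    thus "S (X + Y) = S X + S Y"
      unfolding S_def by (simp add: linear_mapD(2)[OF linI kc[OF X] kc[OF Y]])
  next
    fix c and X :: "complex mat" assume X: "X \<in> carrier_mat (a ^ n) (a ^ n)"
    have "kron (c \<cdot>\<^sub>m X) (max_coh_state d) = c \<cdot>\<^sub>m kron X (max_coh_state d)"
    proof (rule eq_mat_tensorI)
      fix i i' j j' assume "i < a ^ n" "i' < d" "j < a ^ n" "j' < d"
      thus "kron (c \<cdot>\<^sub>m X) (max_coh_state d) $$ (i * d + i', j * d + j')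
          = (c \<cdot>\<^sub>m kron X (max_coh_state d)) $$ (i * d + i', j * d + j')"
        using X mult_add_less[of i "a ^ n" i' d] mult_add_less[of j "a ^ n" j' d]
        by (simp add: kron_index[of _ "a ^ n" "a ^ n" _ d d] mult.assoc carrier_matD[OF kc[OF X]])
    qed (use X kc in auto)
    thus "S (c \<cdot>\<^sub>m X) = c \<cdot>\<^sub>m S X"
      unfolding S_def by (simp add: linear_mapD(3)[OF linI kc[OF X]])
  qed
  have norm: "(\<Sum>i<m. (cmod (max_coh_vec m $ i))\<^sup>2) = 1" if "0 < m" for m
    using that by (simp add: max_coh_vec_def norm_divide power_divide)
  define \<phi> where "\<phi> = max_coh_vec (a ^ n)"
  have \<phi>: "\<phi> \<in> carrier_vec (a ^ n)" by (simp add: \<phi>_def max_coh_vec_def)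
  have "\<phi> \<bullet>c \<phi> = complex_of_real (\<Sum>i<a ^ n. (cmod (\<phi> $ i))\<^sup>2)"
    by (simp add: cscalar_prod_sum[OF \<phi>] complex_norm_square del: of_real_power)
  hence \<phi>1: "\<phi> \<bullet>c \<phi> = 1" using norm[of "a ^ n"] a by (simp add: \<phi>_def)
  have kb: "ket_bra \<phi> = max_coh_state (a ^ n)" by (simp add: \<phi>_def max_coh_state_def)
  define P where "P = S (max_coh_state (a ^ n))"
  define Q where "Q = tensor_power a b T n (max_coh_state (a ^ n))"
  have PQ: "P \<in> carrier_mat (b ^ n) (b ^ n)" "Q \<in> carrier_mat (b ^ n) (b ^ n)"
    unfolding P_def Q_def by (rule linear_mapD(1)[OF linS] linear_mapD(1)[OF linT], simp)+
  have "ereal (trace_norm (P - Q)) \<le> diamond_dist (a ^ n) (b ^ n) S (tensor_power a b T n)"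
    unfolding diamond_dist_def
  proof (rule Sup_upper, intro CollectI exI conjI)
    show "\<phi> \<in> carrier_vec (a ^ n * 1)" using \<phi> by simp
    show "ereal (trace_norm (P - Q)) = ereal (trace_norm (tensor_id (a ^ n) (b ^ n) S 1 (ket_bra \<phi>)
        - tensor_id (a ^ n) (b ^ n) (tensor_power a b T n) 1 (ket_bra \<phi>)))"
      by (simp only: kb tensor_id_one[OF linS max_coh_state_carrier]
          tensor_id_one[OF linT max_coh_state_carrier] P_def Q_def)
  qed (rule \<phi>1)
  hence eps: "trace_norm (P - Q) \<le> \<epsilon>" using dist order_trans by (metis ereal_less_eq(3))
  define V where "V = kron_power W n"
  have V: "V \<in> carrier_mat (b ^ n) (b ^ n)" unfolding V_def by (rule kron_power_carrier[OF W])
  have "cmod (mtrace (V * (P - Q))) \<le> trace_norm (P - Q)"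
  proof (rule norm_mtrace_mult_le_trace_norm[OF V])
    fix x
    have sqV: "V * V = 1\<^sub>m (b ^ n)" unfolding V_def by (rule kron_power_square[OF W sq])
    have hermV: "V $$ (i, j) = cnj (V $$ (j, i))" if "i < b ^ n" "j < b ^ n" for i j
      unfolding V_def by (rule kron_power_hermitian[OF W herm that])
    show "(\<Sum>i<b ^ n. (cmod (\<Sum>j<b ^ n. cnj (V $$ (j, i)) * x j))\<^sup>2) \<le> (\<Sum>i<b ^ n. (cmod (x i))\<^sup>2)"
      by (rule eq_refl[OF hermitian_involution_isometry[OF V sqV hermV]])
  qed (use PQ in auto)
  moreover have "mtrace (V * (P - Q)) = mtrace (V * P) - mtrace (V * Q)"
    by (simp add: mult_minus_distrib_mat[OF V PQ]
        mtrace_minus[OF mult_carrier_mat[OF V PQ(1)] mult_carrier_mat[OF V PQ(2)]])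
  moreover have "mtrace (V * Q) = 1"
    unfolding V_def Q_def mtrace_kron_power_tensor_power[OF T W] test by simp
  ultimately have "cmod (mtrace (V * P) - 1) \<le> \<epsilon>" using eps by simp
  hence le: "1 - cmod (mtrace (V * P)) \<le> \<epsilon>"
    using norm_triangle_ineq2[of 1 "mtrace (V * P)"] by (simp add: norm_minus_commute)
  have P: "P = I (ket_bra (max_coh_vec (a ^ n * d)))"
    by (simp add: P_def S_def kron_max_coh_state max_coh_state_def[symmetric])
  have "cmod (mtrace (V * P)) \<le> u ^ n * real (a ^ n * d) * 1"
  proof -
    have "max_coh_vec (a ^ n * d) \<in> carrier_vec (a ^ n * d)" by (simp add: max_coh_vec_def)
    from norm_mtrace_incoherent_operation_le[OF I this V, of "u ^ n"] norm[of "a ^ n * d"] a d u(2)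
      norm_kron_power_le[OF W u(1) u(2), of _ n] show ?thesis
      by (simp add: V_def P)
  qed
  also have "u ^ n * real (a ^ n * d) * 1 = real d * (real a * u) ^ n"
    by (simp add: power_mult_distrib)
  finally show ?thesis using le by linarith
qed

text \<open>Once the error is below 1/2, taking logarithms in \<open>bound\<close> costs the
  additive constant \<open>log 2 (1 / 2) = -1\<close>, which division by \<open>n\<close> removes in
  the limit.\<close>

lemma C_sim_ge:
  assumes bound: "\<And>n d \<epsilon> I. simulation a b T n d \<epsilon> I \<Longrightarrow> 1 - \<epsilon> \<le> real d * q ^ n" and q: "0 < q"
  shows "C_sim a b T \<ge> ereal (log 2 (1 / q))"
  unfolding C_sim_def
proof (rule Inf_greatest)
  fix x assume "x \<in> {ereal R |R. simulation_achievable a b T R}"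
  then obtain R d \<epsilon> where x: "x = ereal R"
    and sim: "\<And>n. n \<ge> 1 \<Longrightarrow> \<exists>I. simulation a b T n (d n) (\<epsilon> n) I"
    and lim: "(\<lambda>n. 1 / real n * log 2 (real (d n))) \<longlonglongrightarrow> R" and eps: "\<epsilon> \<longlonglongrightarrow> 0"
    unfolding simulation_achievable_def by auto
  have "(\<lambda>n. log 2 (1 / q) - 1 / real n) \<longlonglongrightarrow> log 2 (1 / q) - 0"
    by (intro tendsto_intros lim_1_over_n)
  moreover have "\<forall>\<^sub>F n in sequentially. \<epsilon> n < 1 / 2" by (rule order_tendstoD(2)[OF eps]) simp
  hence "\<forall>\<^sub>F n in sequentially. log 2 (1 / q) - 1 / real n \<le> 1 / real n * log 2 (real (d n))"
    using eventually_ge_at_top[of "1 :: nat"]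
  proof eventually_elim
    case (elim n)
    then obtain I where I: "simulation a b T n (d n) (\<epsilon> n) I" using sim by blast
    have "1 / 2 \<le> real (d n) * q ^ n" using bound[OF I] elim by simp
    moreover have d: "0 < d n" using I by (simp add: simulation_def)
    ultimately have "log 2 (1 / 2) \<le> log 2 (real (d n) * q ^ n)" using q by (subst log_le_cancel_iff) auto
    also have "\<dots> = log 2 (real (d n)) + real n * log 2 q"
      using d q by (simp add: log_mult log_nat_power)
    finally have "real n * log 2 (1 / q) - 1 \<le> log 2 (real (d n))"
      using q by (simp add: log_divide)
    hence "(real n * log 2 (1 / q) - 1) / real n \<le> log 2 (real (d n)) / real n"
      by (intro divide_right_mono) auto
    thus ?case using elim by (simp add: diff_divide_distrib)
  qed
  ultimately have "log 2 (1 / q) \<le> R"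
    using tendsto_le[OF sequentially_bot lim] by simp
  thus "ereal (log 2 (1 / q)) \<le> x" by (simp add: x)
qed

section \<open>The coherence generating capacity\<close>

text \<open>Without any achievable rate the supremum in \<open>C_gen\<close> would be minus
  infinity. One-dimensional auxiliary systems achieve rate 0: the only amplitude of
  \<open>max_coh_vec 1\<close> is 1, the fidelity is the trace of the state, and the error is 0 for
  every \<open>n\<close>.\<close>

lemma generation_achievable_zero:
  assumes T: "cptp a b T" and a: "0 < a"
  shows "generation_achievable a b T 0"
  unfolding generation_achievable_def
proof (intro exI conjI allI impI)
  fix n :: nat
  define \<rho>\<^sub>0 where "\<rho>\<^sub>0 = basis_op (a * 1) 0 0"
  define \<I> :: "nat \<Rightarrow> op_map" where "\<I> = (\<lambda>_. reset_map (a * 1))"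
  let ?\<rho> = "protocol_state a b T (\<lambda>_. 1) \<rho>\<^sub>0 \<I>"
  have IO: "incoherent_operation (b * 1) (a * 1) (\<I> t)" for t
    using a incoherent_operation_reset_map[of "a * 1" "b * 1"] by (simp add: \<I>_def)
  have inc: "incoherent_state (a * 1) (basis_op (a * 1) 0 0)"
    using a by (intro incoherent_state_basis_op) simp
  have \<rho>: "?\<rho> t \<in> carrier_mat a a \<and> mtrace (?\<rho> t) = 1" for t
  proof (induction t)
    case 0
    show ?case using inc by (simp add: \<rho>\<^sub>0_def incoherent_state_def density_def psd_def)
  next
    case (Suc t)
    have "mtrace (tensor_id a b T 1 (?\<rho> t)) = 1"
      using Suc mtrace_tensor_id[OF T, of "?\<rho> t" 1] by simp
    moreover have "tensor_id a b T 1 (?\<rho> t) \<in> carrier_mat (b * 1) (b * 1)" by (rule tensor_map_carrier)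
    ultimately show ?case
      using IO[of "Suc t"] by (simp add: incoherent_operation_def cptp_def linear_map_def)
  qed
  have "generation_protocol a b T n (\<lambda>_. 1) \<rho>\<^sub>0 \<I>"
    unfolding generation_protocol_def using inc IO by (simp add: \<rho>\<^sub>0_def)
  moreover have "(ptrace_fst a 1 (?\<rho> n) *\<^sub>v max_coh_vec 1) \<bullet>c max_coh_vec 1 = 1"
  proof -
    have mc: "max_coh_vec 1 \<in> carrier_vec 1" by (simp add: max_coh_vec_def)
    have mi: "max_coh_vec 1 $ 0 = 1" by (simp add: max_coh_vec_def)
    have pc: "ptrace_fst a 1 (?\<rho> n) \<in> carrier_mat 1 1" by (simp add: ptrace_fst_def)
    have "(ptrace_fst a 1 (?\<rho> n) *\<^sub>v max_coh_vec 1) \<bullet>c max_coh_vec 1 = ptrace_fst a 1 (?\<rho> n) $$ (0, 0)"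
      by (simp add: cscalar_prod_sum[OF mc] mat_mult_vec_index[OF pc mc] mi del: index_mult_mat_vec One_nat_def) simp
    also have "\<dots> = (\<Sum>k<a. ?\<rho> n $$ (k, k))" by (simp add: ptrace_fst_def)
    also have "\<dots> = mtrace (?\<rho> n)" using \<rho> by (intro mtrace_sum[symmetric]) blast
    finally show ?thesis using \<rho> by simp
  qed
  ultimately show "generation_with a b T n ((\<lambda>_. 0) n) ((\<lambda>_. 0) n)"
    unfolding generation_with_def by (intro exI[of _ "\<lambda>_. 1"] exI[of _ \<rho>\<^sub>0] exI[of _ \<I>]) simp
qed simp_all

text \<open>A channel that maps incoherent states to incoherent states keeps every protocol incoherent,
  and an incoherent state of a \<open>d\<close>-dimensional system has fidelity \<open>1/d\<close> with \<open>\<Psi>\<^sub>d\<close>.\<close>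

lemma generation_achievable_nonpos:
  assumes T: "cptp a b T" and diag: "\<And>i. i < a \<Longrightarrow> diagonal_mat (T (basis_op a i i))"
    and R: "generation_achievable a b T R"
  shows "R \<le> 0"
proof (rule ccontr)
  assume "\<not> R \<le> 0"
  hence R0: "R > 0" by simp
  obtain r \<epsilon> where gen: "\<And>n. n \<ge> 1 \<Longrightarrow> generation_with a b T n (r n) (\<epsilon> n)"
    and lim: "r \<longlonglongrightarrow> R" and eps: "\<epsilon> \<longlonglongrightarrow> 0"
    using R unfolding generation_achievable_def by blast
  have "\<forall>\<^sub>F n in sequentially. r n > R / 2"
    using order_tendstoD(1)[OF lim, of "R / 2"] R0 by simp
  moreover have "\<forall>\<^sub>F n in sequentially. \<epsilon> n < 1 / 2"
    using order_tendstoD(2)[OF eps, of "1 / 2"] by simp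
  \<comment> \<open>Together with \<open>r n > R / 2\<close> this makes the target dimension at
    least 2, while fidelity \<open>1 / d n\<close> with an error below 1/2 forces it below
    2.\<close>
  moreover have "\<forall>\<^sub>F n in sequentially. n \<ge> max 1 (nat \<lceil>2 / R\<rceil>)" by (rule eventually_ge_at_top)
  ultimately have "\<forall>\<^sub>F n in sequentially. False"
  proof eventually_elim
    case (elim n)
    obtain d \<rho>\<^sub>0 \<I> where prot: "generation_protocol a b T n d \<rho>\<^sub>0 \<I>"
      and d: "real (d n) = 2 powr (real n * r n)"
      and fid: "Re ((ptrace_fst a (d n) (protocol_state a b T d \<rho>\<^sub>0 \<I> n) *\<^sub>v max_coh_vec (d n))
            \<bullet>c max_coh_vec (d n)) \<ge> 1 - \<epsilon> n"
      using gen[of n] elim unfolding generation_with_def by auto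
    have inc: "incoherent_state (a * d t) (protocol_state a b T d \<rho>\<^sub>0 \<I> t)" if "t \<le> n" for t
      using that
    proof (induction t)
      case 0
      show ?case using prot by (simp add: generation_protocol_def)
    next
      case (Suc t)
      have "incoherent_state (b * d t) (tensor_id a b T (d t) (protocol_state a b T d \<rho>\<^sub>0 \<I> t))"
        using Suc by (intro incoherent_state_tensor_id[OF T diag]) auto
      moreover have "incoherent_operation (b * d t) (a * d (Suc t)) (\<I> (Suc t))"
        using prot Suc.prems by (simp add: generation_protocol_def)
      ultimately show ?case using incoherent_state_incoherent_operation by simp
    qed
    have "0 < d n" using prot by (simp add: generation_protocol_def)
    hence "1 - \<epsilon> n \<le> 1 / real (d n)" using fid fidelity_incoherent_state[OF inc[of n]] by simp
    hence "1 / 2 < 1 / real (d n)" using elim by simp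
    hence "real (d n) < 2" using \<open>0 < d n\<close> by (simp add: field_simps)
    moreover have "2 \<le> real (d n)"
    proof -
      have "2 / R \<le> real n" using elim by linarith
      hence "1 \<le> real n * (R / 2)" using R0 by (simp add: field_simps)
      also have "\<dots> \<le> real n * r n" using elim by (intro mult_left_mono) auto
      finally have "2 powr 1 \<le> 2 powr (real n * r n)" by (intro powr_mono) simp_all
      thus ?thesis using d by simp
    qed
    ultimately show False by simp
  qed
  thus False by simp
qed

text \<open>The Paley conference matrix of order \<open>6\<close>: the quadratic residue character of \<open>i - j\<close>
  modulo \<open>5\<close>, bordered by ones.\<close>

definition paley :: "nat \<Rightarrow> nat \<Rightarrow> int" where
  "paley i j = (if i = j then 0 else if i = 5 \<or> j = 5 \<or> (int i - int j)\<^sup>2 mod 5 = 1 then 1 else - 1)"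

text \<open>The character is even since -1 is a square modulo 5. Evenness is built into the
  encoding: the nonzero squares modulo 5 are 1 and -1, the classes whose own square is 1.\<close>

lemma paley_sym: "paley i j = paley j i"
  by (simp add: paley_def power2_commute)

text \<open>A finite check of 36 index pairs; lists replace the index sets so that the claim can be
  evaluated.\<close>

lemma paley_square:
  assumes "i < 6" "j < 6"
  shows "(\<Sum>k<6. paley i k * paley k j) = (if i = j then 5 else 0)"
proof -
  have "\<forall>i\<in>set [0..<6]. \<forall>j\<in>set [0..<6].
      (\<Sum>k\<leftarrow>[0..<6]. paley i k * paley k j) = (if i = j then 5 else 0)"
    by code_simp
  thus ?thesis using assms
    by (simp add: sum_list_distinct_conv_sum_set atLeast0LessThan)
qed

lemma abs_paley_le: "\<bar>paley i j\<bar> \<le> 1"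
  by (simp add: paley_def)

section \<open>Bound coherence\<close>

theorem mainTheorem6:
  shows "\<exists>(a::nat) (b::nat) (T :: complex mat \<Rightarrow> complex mat).
    0 < a \<and> 0 < b \<and> cptp a b T \<and> C_gen a b T = 0 \<and> C_sim a b T > 0"
proof -
  define U where "U i j = real_of_int (paley i j) / sqrt 5" for i j
  define T where "T = flip_map 6 U"
  define W where "W = mat 6 6 (\<lambda>(i, j). complex_of_real (U i j))"
  \<comment> \<open>The input dimension 2 times the entry bound \<open>1 / sqrt 5\<close>; it is
    below 1 because 4 < 5.\<close>
  define q where "q = 2 / sqrt 5"
  have sym: "U i j = U j i" for i j by (simp add: U_def paley_sym[of i j])
  have sq: "(\<Sum>t<6. U k t * U t l) = (if k = l then 1 else 0)" if "k < 6" "l < 6" for k l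
  proof -
    have "(\<Sum>t<6. U k t * U t l) = (\<Sum>t<6. real_of_int (paley k t * paley t l)) / 5"
      by (simp add: U_def sum_divide_distrib)
    also have "\<dots> = real_of_int (\<Sum>t<6. paley k t * paley t l) / 5" by (simp only: of_int_sum)
    also have "\<dots> = (if k = l then 1 else 0)" by (simp add: paley_square[OF that])
    finally show ?thesis .
  qed
  have tr: "(\<Sum>k<6. U k k) = 0" by (simp add: U_def paley_def)
  have T: "cptp 2 6 T" unfolding T_def by (rule cptp_flip_map[OF _ sym sq tr]) auto
  hence lin: "linear_map 2 6 T" by (simp add: cptp_def)
  have diag: "diagonal_mat (T (basis_op 2 i i))" for i
    unfolding T_def by (rule diagonal_flip_map_basis_op)
  have "C_gen 2 6 T = 0"
    unfolding C_gen_def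
  proof (rule antisym)
    show "Sup {ereal R |R. generation_achievable 2 6 T R} \<le> 0"
      using generation_achievable_nonpos[OF T diag] by (auto intro!: Sup_least)
    show "0 \<le> Sup {ereal R |R. generation_achievable 2 6 T R}"
      using generation_achievable_zero[OF T] by (intro Sup_upper) (auto simp: zero_ereal_def)
  qed
  moreover have "C_sim 2 6 T > 0"
  proof -
    have Wc: "W \<in> carrier_mat 6 6" by (simp add: W_def)
    have Widx: "W $$ (i, j) = of_real (U i j)" if "i < 6" "j < 6" for i j using that by (simp add: W_def)
    have WW: "W * W = 1\<^sub>m 6"
    proof (rule eq_matI)
      fix i j assume "i < dim_row (1\<^sub>m 6 :: complex mat)" "j < dim_col (1\<^sub>m 6 :: complex mat)"
      hence ij: "i < 6" "j < 6" by auto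
      have "(W * W) $$ (i, j) = of_real (\<Sum>t<6. U i t * U t j)"
        using ij by (subst mat_mult_index[OF Wc Wc]) (auto simp: Widx)
      thus "(W * W) $$ (i, j) = 1\<^sub>m 6 $$ (i, j)" using ij by (simp add: sq)
    qed (simp_all add: W_def)
    have herm: "W $$ (i, j) = cnj (W $$ (j, i))" if "i < 6" "j < 6" for i j
      using that sym[of i j] by (simp add: Widx)
    have u: "cmod (W $$ (i, j)) \<le> 1 / sqrt 5" if "i < 6" "j < 6" for i j
    proof -
      have "\<bar>real_of_int (paley i j)\<bar> \<le> 1" using abs_paley_le[of i j] by linarith
      thus ?thesis using that by (simp add: Widx U_def norm_divide divide_right_mono)
    qed
    \<comment> \<open>The image of the maximally coherent qubit is \<open>(1 + U) / 6\<close>, and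
      \<open>U * (1 + U) = U + 1\<close> has trace 6.\<close>
    have test: "mtrace (W * T (max_coh_state 2)) = 1"
    proof -
      have Tc: "T (max_coh_state 2) \<in> carrier_mat 6 6" by (rule linear_mapD(1)[OF lin max_coh_state_carrier])
      have Ti: "T (max_coh_state 2) $$ (l, k) = of_real (((if l = k then 1 else 0) + U l k) / 6)"
        if "l < 6" "k < 6" for k l
        using that by (simp add: T_def flip_map_def max_coh_state_eq numeral_2_eq_2)
      have "mtrace (W * T (max_coh_state 2))
          = (\<Sum>k<6. \<Sum>l<6. of_real (U k l * (((if l = k then 1 else 0) + U l k) / 6)))"
        by (subst mtrace_sum[OF mult_carrier_mat[OF Wc Tc]])
          (auto simp: mat_mult_index[OF Wc Tc] Widx Ti simp del: index_mult_mat(1) intro!: sum.cong)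
      also have "\<dots> = of_real (\<Sum>k<6. \<Sum>l<6. U k l * (((if l = k then 1 else 0) + U l k) / 6))"
        by simp
      also have "(\<Sum>k<6. \<Sum>l<6. U k l * (((if l = k then 1 else 0) + U l k) / 6))
          = (\<Sum>k<6. (\<Sum>l<6. if l = k then U k l else 0) + (\<Sum>l<6. U k l * U l k)) / 6"
        unfolding sum_divide_distrib sum.distrib[symmetric]
        by (intro sum.cong refl) (simp add: sum_divide_distrib algebra_simps)
      also have "\<dots> = (\<Sum>k<6. U k k + 1) / 6" by (simp add: sq)
      also have "\<dots> = 1" using tr by (simp add: sum.distrib)
      finally show ?thesis by simp
    qed
    have "1 - \<epsilon> \<le> real d * q ^ n" if "simulation 2 6 T n d \<epsilon> I" for n d \<epsilon> I
      using simulation_bound[OF lin _ Wc WW herm u _ test that] by (simp add: q_def)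
    hence "C_sim 2 6 T \<ge> ereal (log 2 (1 / q))" by (intro C_sim_ge) (auto simp: q_def)
    moreover have "sqrt 4 < sqrt 5" by (subst real_sqrt_less_iff) simp
    hence "1 / q > 1" by (simp add: q_def)
    hence "0 < log 2 (1 / q)" by (subst zero_less_log_cancel_iff) linarith+
    hence "ereal (log 2 (1 / q)) > 0" by simp
    ultimately show ?thesis by (rule less_le_trans[rotated])
  qed
  ultimately show ?thesis using T by (intro exI[of _ 2] exI[of _ 6] exI[of _ T]) simp
qed

end
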